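(* $m(3) \ge 12$. That is, the vanishing of the first $11$ focal values does not imply the vanishing of all focal values for plane systems of degree at most $3$: there exist polynomials $p,q\in\mathbb{C}[x,y]$ of degree at most $3$, with only terms of degree $2$ and $3$, such that the focal values of $P\,dx+Q\,dy$ with $P=x+p$, $Q=y+q$ satisfy $s_1=s_2=\dots=s_{11}=0$ but $s_j\neq 0$ for some $j\ge 12$.
   Context: Let $d\ge 2$. Consider $P(x,y)=x+p(x,y)$ and $Q(x,y)=y+q(x,y)$, where $p,q$ are polynomials of degree at most $d$ all of whose terms have degree at least $2$ (associated plane autonomous system: $\dot x=Q(x,y)$, $\dot y=-P(x,y)$). For $d=3$ the pair $(p,q)$ has $14$ coefficients. Focal values: one can iteratively find a formal power series $F=x^2+y^2+f_3(x,y)+f_4(x,y)+\cdots$, with $f_k$ homogeneous of degree $k$ in $x,y$, such that $$\det\begin{pmatrix}F_x&F_y\\P&Q\end{pmatrix}=F_xQ-F_yP=\sum_{j=1}^\infty s_j\,(x^{2j+2}+y^{2j+2}),$$ where the $s_j$ (and the coefficients of the $f_k$) are polynomials with rational coefficients in the coefficients of $p$ and $q$. For odd $k$, $f_k$ is determined by the previous terms; for even $k$, it is determined up to adding a multiple of $(x^2+y^2)^{k/2}$. Fix any such choice (polynomial in the coefficients of $p,q$, with rational coefficients). The $s_j$ are called the focal values of $P\,dx+Q\,dy$. By Hilbert's Basis Theorem there is an integer $m$ such that, for all polynomials $p,q\in\mathbb{C}[x,y]$ of degree at most $d$ all of whose terms have degree at least $2$, the vanishing $s_1=\dots=s_m=0$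 of the first $m$ focal values of $P\,dx+Q\,dy$ with $P=x+p$, $Q=y+q$ implies $s_j=0$ for all $j$. The least such $m$ is denoted $m(d)$. *)

theory Defs
  imports
    "HOL-Computational_Algebra.Computational_Algebra"
    "HOL-Library.Extended_Nat"
begin

text \<open>Polynomials and formal power series in \<open>x, y\<close> are iterated univariate ones, with \<open>x\<close> the
  outer and \<open>y\<close> the inner variable: the coefficient of \<open>x\<^sup>i y\<^sup>j\<close> in \<open>p\<close> is
  \<open>coeff (coeff p i) j\<close>, and in \<open>F\<close> it is \<open>F $ i $ j\<close>.\<close>

type_synonym poly2 = "complex poly poly"
type_synonym fps2 = "complex fps fps"

unbundle fps_syntax

definition X2 :: poly2 where
  "X2 = monom 1 1"

definition Y2 :: poly2 where
  "Y2 = [:monom 1 1:]"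

definition fps2_of_poly2 :: "poly2 \<Rightarrow> fps2" where
  "fps2_of_poly2 p = fps_of_poly (map_poly fps_of_poly p)"

definition deriv_x :: "fps2 \<Rightarrow> fps2" where
  "deriv_x F = fps_deriv F"

definition deriv_y :: "fps2 \<Rightarrow> fps2" where
  "deriv_y F = Abs_fps (\<lambda>i. fps_deriv (F $ i))"

definition nonlinear_part :: "nat \<Rightarrow> poly2 \<Rightarrow> bool" where
  "nonlinear_part d p \<longleftrightarrow>
     (\<forall>i j. coeff (coeff p i) j \<noteq> 0 \<longrightarrow> 2 \<le> i + j \<and> i + j \<le> d)"

text \<open>With \<open>G(t) = (\<Sum>j\<ge>1. s\<^sub>j t\<^bsup>2j+2\<^esup>)\<close>, the right-hand side of the defining equation of the
  focal values is \<open>G(x) + G(y)\<close>. It is assembled from coefficients because the series does not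
  converge in the topology of the outer variable. The value \<open>s 0\<close> is not used.\<close>

definition focal_gf :: "(nat \<Rightarrow> complex) \<Rightarrow> complex fps" where
  "focal_gf s = Abs_fps (\<lambda>n. if even n \<and> 4 \<le> n then s (n div 2 - 1) else 0)"

definition focal_rhs :: "(nat \<Rightarrow> complex) \<Rightarrow> fps2" where
  "focal_rhs s = Abs_fps (\<lambda>i. fps_const (focal_gf s $ i)) + fps_const (focal_gf s)"

definition focal_equation :: "poly2 \<Rightarrow> poly2 \<Rightarrow> fps2 \<Rightarrow> (nat \<Rightarrow> complex) \<Rightarrow> bool" where
  "focal_equation p q F s \<longleftrightarrow>
     (\<forall>i j. i + j \<le> 2 \<longrightarrow> F $ i $ j = (if (i, j) \<in> {(2, 0), (0, 2)} then 1 else 0)) \<and>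
     deriv_x F * fps2_of_poly2 (Y2 + q) - deriv_y F * fps2_of_poly2 (X2 + p) = focal_rhs s"

text \<open>Polynomials with rational coefficients in the coefficients of \<open>p\<close> and \<open>q\<close> belonging to terms
  of degree between \<open>2\<close> and \<open>d\<close> (14 of them if \<open>d = 3\<close>), viewed as functions of \<open>(p, q)\<close>.\<close>

inductive rat_poly_in_coeffs :: "nat \<Rightarrow> (poly2 \<Rightarrow> poly2 \<Rightarrow> complex) \<Rightarrow> bool" for d where
  const: "rat_poly_in_coeffs d (\<lambda>p q. of_rat c)"
| coeff_p: "2 \<le> i + j \<Longrightarrow> i + j \<le> d \<Longrightarrow> rat_poly_in_coeffs d (\<lambda>p q. coeff (coeff p i) j)"
| coeff_q: "2 \<le> i + j \<Longrightarrow> i + j \<le> d \<Longrightarrow> rat_poly_in_coeffs d (\<lambda>p q. coeff (coeff q i) j)"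
| add: "rat_poly_in_coeffs d g \<Longrightarrow> rat_poly_in_coeffs d h \<Longrightarrow>
          rat_poly_in_coeffs d (\<lambda>p q. g p q + h p q)"
| mult: "rat_poly_in_coeffs d g \<Longrightarrow> rat_poly_in_coeffs d h \<Longrightarrow>
          rat_poly_in_coeffs d (\<lambda>p q. g p q * h p q)"

text \<open>\<open>F p q\<close> and \<open>s p q\<close> are an admissible choice of the formal series and of the focal values
  \<open>s\<^sub>1, s\<^sub>2, \<dots>\<close> of \<open>P dx + Q dy\<close>, \<open>P = x + p\<close>, \<open>Q = y + q\<close>. The choice is not unique, since
  multiples of \<open>(x\<^sup>2 + y\<^sup>2)\<^sup>n\<close> may be added to the homogeneous part of \<open>F\<close> of degree \<open>2n\<close>.\<close>

definition focal_values ::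
  "nat \<Rightarrow> (poly2 \<Rightarrow> poly2 \<Rightarrow> fps2) \<Rightarrow> (poly2 \<Rightarrow> poly2 \<Rightarrow> nat \<Rightarrow> complex) \<Rightarrow> bool" where
  "focal_values d F s \<longleftrightarrow>
     (\<forall>i j. rat_poly_in_coeffs d (\<lambda>p q. F p q $ i $ j)) \<and>
     (\<forall>j\<ge>1. rat_poly_in_coeffs d (\<lambda>p q. s p q j)) \<and>
     (\<forall>p q. nonlinear_part d p \<longrightarrow> nonlinear_part d q \<longrightarrow> focal_equation p q (F p q) (s p q))"

definition vanishing_suffices ::
  "nat \<Rightarrow> (poly2 \<Rightarrow> poly2 \<Rightarrow> nat \<Rightarrow> complex) \<Rightarrow> nat \<Rightarrow> bool" where
  "vanishing_suffices d s m \<longleftrightarrow>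
     (\<forall>p q. nonlinear_part d p \<longrightarrow> nonlinear_part d q \<longrightarrow>
        (\<forall>j\<in>{1..m}. s p q j = 0) \<longrightarrow> (\<forall>j\<ge>1. s p q j = 0))"

text \<open>The least \<open>m\<close> such that the vanishing of the first \<open>m\<close> focal values suffices. Hilbert's Basis
  Theorem shows it to be finite; the infimum in \<open>enat\<close> makes the definition independent of this.\<close>

definition m_focal :: "nat \<Rightarrow> (poly2 \<Rightarrow> poly2 \<Rightarrow> nat \<Rightarrow> complex) \<Rightarrow> enat" where
  "m_focal d s = (INF m\<in>{m. vanishing_suffices d s m}. enat m)"

end

theory Submission
  imports Defs "HOL-Analysis.Brouwer_Fixpoint"
begin

unbundle no vec_syntax

text \<open>
  In the complex coordinates \<open>u = x + i y\<close>, \<open>v = x - i y\<close> consider the systems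
  \<open>u' = -i u (1 + v + B v\<^sup>2)\<close>, \<open>v' = -i (-v + C v\<^sup>2 + D v\<^sup>3 + u\<^sup>3)\<close>, whose symmetry \<open>u \<mapsto> \<omega> u\<close> with
  \<open>\<omega>\<^sup>3 = 1\<close> forces every focal value to vanish whose index is not a multiple of \<open>3\<close>. The conditions
  \<open>s\<^sub>3 = s\<^sub>6 = s\<^sub>9 = 0\<close> are three polynomial equations in the three unknowns \<open>B, C, D\<close>. They have a
  real solution with \<open>s\<^sub>1\<^sub>2 \<noteq> 0\<close>, by Brouwer's fixed point theorem on a small box on which the
  equations are enclosed by first-order Taylor models with integer coefficients.

  The index of the first nonvanishing focal value does not depend on the choice of the series: if
  \<open>G = u v + \<dots>\<close> has derivative \<open>c (u v)\<^sup>n\<close> up to higher order along the system, then an admissible series is a power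
  series in \<open>G\<close> up to order \<open>2 n\<close>, because only powers of \<open>u v\<close> are annihilated by the rotation.\<close>

section \<open>Invariance of the first nonvanishing focal value\<close>

definition order_ge :: "nat \<Rightarrow> fps2 \<Rightarrow> bool" where
  "order_ge N H \<longleftrightarrow> (\<forall>i j. i + j < N \<longrightarrow> H $ i $ j = 0)"

lemma order_geD: "order_ge N H \<Longrightarrow> i + j < N \<Longrightarrow> H $ i $ j = 0"
  by (simp add: order_ge_def)

lemma order_ge_mono: "order_ge N H \<Longrightarrow> M \<le> N \<Longrightarrow> order_ge M H"
  by (simp add: order_ge_def)

lemma order_ge_0 [simp]: "order_ge N 0"
  by (simp add: order_ge_def)

lemma order_ge_0_left [simp]: "order_ge 0 H"
  by (simp add: order_ge_def)

lemma order_ge_add: "order_ge N H \<Longrightarrow> order_ge N K \<Longrightarrow> order_ge N (H + K)"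
  by (simp add: order_ge_def)

lemma order_ge_diff: "order_ge N H \<Longrightarrow> order_ge N K \<Longrightarrow> order_ge N (H - K)"
  by (simp add: order_ge_def)

lemma order_ge_minus: "order_ge N H \<Longrightarrow> order_ge N (- H)"
  by (simp add: order_ge_def)

lemma order_ge_sum: "(\<And>x. x \<in> A \<Longrightarrow> order_ge N (f x)) \<Longrightarrow> order_ge N (sum f A)"
  by (induction A rule: infinite_finite_induct) (auto intro: order_ge_add)

lemma fps2_mult_nth:
  "(H * K :: fps2) $ i $ j = (\<Sum>a=0..i. \<Sum>b=0..j. H $ a $ b * K $ (i - a) $ (j - b))"
  by (simp add: fps_mult_nth fps_sum_nth)

lemma order_ge_mult:
  assumes "order_ge M H" "order_ge N K"
  shows "order_ge (M + N) (H * K)"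
  unfolding order_ge_def
proof (intro allI impI)
  fix i j :: nat
  assume ij: "i + j < M + N"
  have "H $ a $ b * K $ (i - a) $ (j - b) = 0" if "a \<in> {0..i}" "b \<in> {0..j}" for a b
  proof (cases "a + b < M")
    case True
    then show ?thesis using order_geD[OF assms(1)] by simp
  next
    case False
    then have "(i - a) + (j - b) < N" using that ij by auto
    then show ?thesis using order_geD[OF assms(2)] by simp
  qed
  then show "(H * K) $ i $ j = 0" unfolding fps2_mult_nth by (intro sum.neutral ballI) blast
qed

lemma order_ge_mult_left: "order_ge N K \<Longrightarrow> order_ge N (H * K)"
  using order_ge_mult[of 0 H N K] by simp

lemma order_ge_power: "order_ge M H \<Longrightarrow> order_ge (n * M) (H ^ n)"
  by (induction n) (auto dest: order_ge_mult)

definition scalar :: "complex \<Rightarrow> fps2" where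
  "scalar c = fps_const (fps_const c)"

lemma scalar_mult_nth [simp]: "(scalar c * H) $ i $ j = c * H $ i $ j"
  by (simp add: scalar_def)

lemma scalar_add: "scalar (a + b) = scalar a + scalar b"
  by (simp add: scalar_def)

lemma scalar_mult: "scalar (a * b) = scalar a * scalar b"
  by (simp add: scalar_def)

lemma scalar_diff: "scalar (a - b) = scalar a - scalar b"
  by (simp add: scalar_def)

lemma scalar_minus: "scalar (- a) = - scalar a"
  by (simp add: scalar_def)

lemma scalar_0 [simp]: "scalar 0 = 0" and scalar_1 [simp]: "scalar 1 = 1"
  by (simp_all add: scalar_def)

lemma scalar_of_nat: "scalar (of_nat n) = of_nat n"
  by (simp add: scalar_def fps_of_nat)

section \<open>Partial derivatives and the derivation along a vector field\<close>

lemma deriv_x_nth: "deriv_x H $ i $ j = of_nat (Suc i) * H $ Suc i $ j"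
  by (simp add: deriv_x_def fps_of_nat[symmetric] del: of_nat_Suc)

lemma deriv_y_nth: "deriv_y H $ i $ j = of_nat (Suc j) * H $ i $ Suc j"
  by (simp add: deriv_y_def)

lemma deriv_x_mult: "deriv_x (H * K) = deriv_x H * K + H * deriv_x K"
  by (simp add: deriv_x_def mult.commute add.commute)

lemma deriv_y_mult: "deriv_y (H * K) = deriv_y H * K + H * deriv_y K"
proof (rule fps_ext)
  fix i
  have "deriv_y (H * K) $ i = (\<Sum>k=0..i. fps_deriv (H $ k * K $ (i - k)))"
    by (simp add: deriv_y_def fps_mult_nth fps_deriv_sum)
  also have "\<dots> = (deriv_y H * K + H * deriv_y K) $ i"
    by (simp add: deriv_y_def fps_mult_nth sum.distrib add.commute)
  finally show "deriv_y (H * K) $ i = (deriv_y H * K + H * deriv_y K) $ i" .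
qed

text \<open>The derivative along the vector field \<open>x' = Q\<close>, \<open>y' = - P\<close>;
  the focal equation says that it takes \<open>F\<close> to \<open>focal_rhs s\<close>.\<close>

definition lie :: "fps2 \<Rightarrow> fps2 \<Rightarrow> fps2 \<Rightarrow> fps2" where
  "lie P Q H = deriv_x H * Q - deriv_y H * P"

lemma deriv_x_add: "deriv_x (H + K) = deriv_x H + deriv_x K"
  by (simp add: deriv_x_def)

lemma deriv_y_add: "deriv_y (H + K) = deriv_y H + deriv_y K"
  by (rule fps_ext) (simp add: deriv_y_def)

lemma deriv_scalar [simp]: "deriv_x (scalar c) = 0" "deriv_y (scalar c) = 0"
  by (auto simp: fps_eq_iff deriv_x_nth deriv_y_nth scalar_def)

lemma lie_add: "lie P Q (H + K) = lie P Q H + lie P Q K"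
  by (simp add: lie_def deriv_x_add deriv_y_add algebra_simps)

lemma lie_mult: "lie P Q (H * K) = lie P Q H * K + H * lie P Q K"
  by (simp add: lie_def deriv_x_mult deriv_y_mult algebra_simps)

lemma lie_scalar_mult: "lie P Q (scalar c * H) = scalar c * lie P Q H"
  by (simp add: lie_mult) (simp add: lie_def)

lemma lie_diff: "lie P Q (H - K) = lie P Q H - lie P Q K"
  using lie_add[of P Q "H - K" K] by simp

lemma lie_0 [simp]: "lie P Q 0 = 0"
  using lie_scalar_mult[of P Q 0 0] by simp

lemma lie_1 [simp]: "lie P Q 1 = 0"
  using lie_mult[of P Q 1 1] by simp

lemma lie_sum: "lie P Q (sum f A) = (\<Sum>x\<in>A. lie P Q (f x))"
  by (induction A rule: infinite_finite_induct) (simp_all add: lie_add)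

lemma lie_power: "lie P Q (H ^ n) = of_nat n * H ^ (n - 1) * lie P Q H"
proof (induction n)
  case (Suc n)
  then show ?case by (cases n) (simp_all add: lie_mult algebra_simps)
qed simp

lemma order_ge_deriv:
  assumes "order_ge N H"
  shows "order_ge (N - 1) (deriv_x H)" "order_ge (N - 1) (deriv_y H)"
  using assms by (auto simp: order_ge_def deriv_x_nth deriv_y_nth)

section \<open>The rotation on homogeneous forms: its image and its kernel\<close>

definition fps2_X :: fps2 where "fps2_X = fps_X"
definition fps2_Y :: fps2 where "fps2_Y = fps_const fps_X"

lemma mult_fps2_X_nth: "(H * fps2_X) $ i $ j = (if i = 0 then 0 else H $ (i - 1) $ j)"
  by (simp add: fps2_X_def)

lemma mult_fps2_Y_nth: "(H * fps2_Y) $ i $ j = (if j = 0 then 0 else H $ i $ (j - 1))"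
  by (simp add: fps2_Y_def)

definition rotation_like :: "fps2 \<Rightarrow> fps2 \<Rightarrow> bool" where
  "rotation_like P Q \<longleftrightarrow> order_ge 2 (P - fps2_X) \<and> order_ge 2 (Q - fps2_Y)"

text \<open>The nonlinear terms of \<open>P\<close> and \<open>Q\<close> raise the degree, so in
  degree \<open>N\<close> only the rotation \<open>y d/dx - x d/dy\<close> acts, on the part of
  \<open>H\<close> of degree \<open>N\<close>.\<close>

lemma lie_leading_nth:
  assumes "rotation_like P Q" "order_ge N H" "i + j = N"
  shows "lie P Q H $ i $ j =
    (if j = 0 then 0 else of_nat (Suc i) * H $ Suc i $ (j - 1)) -
    (if i = 0 then 0 else of_nat (Suc j) * H $ (i - 1) $ Suc j)"
proof (cases "N = 0")
  case True
  then have "P $ 0 $ 0 = 0" "Q $ 0 $ 0 = 0"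
    using assms(1) by (auto simp: rotation_like_def order_ge_def fps2_X_def fps2_Y_def)
  then show ?thesis using True assms(3) by (simp add: lie_def fps_mult_nth)
next
  case False
  have "lie P Q H = deriv_x H * fps2_Y - deriv_y H * fps2_X
     + (deriv_x H * (Q - fps2_Y) - deriv_y H * (P - fps2_X))"
    by (simp add: lie_def algebra_simps)
  moreover have "order_ge (N - 1 + 2) (deriv_x H * (Q - fps2_Y) - deriv_y H * (P - fps2_X))"
    using order_ge_mult[OF order_ge_deriv(1)[OF assms(2)]] order_ge_mult[OF order_ge_deriv(2)[OF assms(2)]]
      assms(1) unfolding rotation_like_def by (blast intro: order_ge_diff)
  ultimately have "lie P Q H $ i $ j = (deriv_x H * fps2_Y) $ i $ j - (deriv_y H * fps2_X) $ i $ j"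
    using assms(3) False by (simp add: order_ge_def)
  then show ?thesis
    by (simp add: mult_fps2_X_nth mult_fps2_Y_nth deriv_x_nth deriv_y_nth)
qed

text \<open>Integrating a form against the Gaussian measure of the plane annihilates the image of the rotation
  \<open>y \<partial>\<^sub>x - x \<partial>\<^sub>y\<close>, since the measure is rotation invariant.\<close>

fun gauss_moment :: "nat \<Rightarrow> nat" where
  "gauss_moment 0 = 1"
| "gauss_moment (Suc 0) = 0"
| "gauss_moment (Suc (Suc n)) = Suc n * gauss_moment n"

lemma gauss_moment_pos: "even n \<Longrightarrow> gauss_moment n > 0"
  by (induction n rule: gauss_moment.induct) auto

definition mean :: "nat \<Rightarrow> fps2 \<Rightarrow> complex" where
  "mean N H = (\<Sum>i\<le>N. of_nat (gauss_moment i * gauss_moment (N - i)) * H $ i $ (N - i))"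

text \<open>The recursion of \<open>gauss_moment\<close> absorbs the factors produced by
  differentiation. The two halves of the rotation become shifts of one sequence \<open>w\<close>,
  and their difference telescopes.\<close>

lemma mean_lie:
  assumes "rotation_like P Q" "order_ge N H"
  shows "mean N (lie P Q H) = 0"
proof -
  define w where "w = (\<lambda>i. of_nat (gauss_moment (Suc i) * gauss_moment (Suc (N - i))) * H $ i $ (N - i))"
  have "mean N (lie P Q H) =
     (\<Sum>i\<le>N. if i = N then 0 else w (Suc i)) - (\<Sum>i\<le>N. if i = 0 then 0 else w (i - 1))"
    unfolding mean_def sum_subtractf[symmetric]
  proof (rule sum.cong[OF refl])
    fix i assume "i \<in> {..N}"
    then have i: "i \<le> N" by simp
    have 1: "of_nat (gauss_moment i * gauss_moment (N - i)) *
        (if N - i = 0 then 0 else of_nat (Suc i) * H $ Suc i $ (N - i - 1)) = (if i = N then 0 else w (Suc i))"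
    proof (cases "i = N")
      case False
      then show ?thesis using i by (simp add: w_def Suc_diff_Suc algebra_simps)
    qed simp
    have 2: "of_nat (gauss_moment i * gauss_moment (N - i)) *
        (if i = 0 then 0 else of_nat (Suc (N - i)) * H $ (i - 1) $ Suc (N - i)) = (if i = 0 then 0 else w (i - 1))"
    proof (cases i)
      case (Suc k)
      moreover obtain d where "N = Suc k + d" using i Suc le_Suc_ex by blast
      ultimately show ?thesis by (simp add: w_def algebra_simps)
    qed simp
    show "of_nat (gauss_moment i * gauss_moment (N - i)) * lie P Q H $ i $ (N - i) =
        (if i = N then 0 else w (Suc i)) - (if i = 0 then 0 else w (i - 1))"
      unfolding lie_leading_nth[OF assms le_add_diff_inverse[OF i]] right_diff_distrib 1 2 ..
  qed
  also have "(\<Sum>i\<le>N. if i = N then 0 else w (Suc i)) = (\<Sum>i<N. w (Suc i))"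
    by (cases N) (simp_all add: lessThan_Suc_atMost[symmetric])
  also have "(\<Sum>i\<le>N. if i = 0 then 0 else w (i - 1)) = (\<Sum>i<N. w i)"
    by (cases N) (simp_all add: sum.atMost_Suc_shift lessThan_Suc_atMost del: sum.atMost_Suc)
  also have "(\<Sum>i<N. w (Suc i)) - (\<Sum>i<N. w i) = w N - w 0"
    by (simp add: sum_subtractf[symmetric] sum_lessThan_telescope)
  \<comment> \<open>Both boundary terms contain the first moment
    \<open>gauss_moment (Suc 0) = 0\<close>.\<close>
  also have "\<dots> = 0" by (simp add: w_def)
  finally show ?thesis .
qed

text \<open>In degree \<open>N\<close> the vanishing derivative links coefficients whose exponents
  differ by two. The chain of odd exponents of \<open>x\<close> starts from zero at one end, and
  likewise that of odd exponents of \<open>y\<close> at the other. For odd \<open>N\<close> these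
  chains cover everything. For even \<open>N\<close> the chain of even exponents remains, and the
  coefficient of \<open>y^N\<close> determines it.\<close>

lemma lie_kernel:
  assumes PQ: "rotation_like P Q" and H: "order_ge N H"
    and lie: "\<And>i j. i + j = N \<Longrightarrow> lie P Q H $ i $ j = 0"
    and start: "odd N \<or> H $ 0 $ N = 0"
  shows "order_ge (Suc N) H"
proof -
  have step: "H $ Suc i $ (j - 1) = 0"
    if "i + j = N" "j > 0" "i > 0 \<Longrightarrow> H $ (i - 1) $ Suc j = 0" for i j
  proof -
    have "of_nat (Suc i) * H $ Suc i $ (j - 1) = 0"
      using lie_leading_nth[OF PQ H that(1)] lie[OF that(1)] that(2,3) by (cases "i = 0") auto
    then show ?thesis by (simp del: of_nat_Suc)
  qed
  have odd_zero: "H $ i $ (N - i) = 0" if "odd i" "i \<le> N" for i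
    using that
  \<comment> \<open>The rule serves only as induction in steps of two.\<close>
  proof (induction i rule: gauss_moment.induct)
    case 2
    then show ?case using step[of 0 N] by simp
  next
    case (3 n)
    then show ?case using step[of "Suc n" "N - Suc n"] by (simp add: Suc_diff_Suc)
  qed simp
  have bwd: "H $ (i - 1) $ Suc j = 0"
    if "i + j = N" "i > 0" "j > 0 \<Longrightarrow> H $ Suc i $ (j - 1) = 0" for i j
  proof -
    have "of_nat (Suc j) * H $ (i - 1) $ Suc j = 0"
      using lie_leading_nth[OF PQ H that(1)] lie[OF that(1)] that(2,3) by (cases "j = 0") auto
    then show ?thesis by (simp del: of_nat_Suc)
  qed
  have odd_zero': "H $ (N - j) $ j = 0" if "odd j" "j \<le> N" for j
    using that
  proof (induction j rule: gauss_moment.induct)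
    case 2
    then show ?case using bwd[of N 0] by simp
  next
    case (3 n)
    then show ?case using bwd[of "N - Suc n" "Suc n"] by (simp add: Suc_diff_Suc)
  qed simp
  have even_zero: "H $ i $ (N - i) = 0" if "even N" "even i" "i \<le> N" for i
    using that(2,3)
  proof (induction i rule: gauss_moment.induct)
    case 1
    then show ?case using start \<open>even N\<close> by simp
  next
    case (3 n)
    then show ?case using step[of "Suc n" "N - Suc n"] by (simp add: Suc_diff_Suc)
  qed simp
  have "H $ i $ j = 0" if "i + j = N" for i j
  proof (cases "odd i")
    case True
    then show ?thesis using odd_zero[of i] that by auto
  next
    case False
    then show ?thesis using even_zero[of i] odd_zero'[of j] that by (cases "even N") auto
  qed
  then show ?thesis using H unfolding order_ge_def less_Suc_eq by blast
qed

lemma mean_diff: "mean N (H - K) = mean N H - mean N K"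
  by (simp add: mean_def sum_subtractf algebra_simps)

lemma mean_scalar_mult: "mean N (scalar c * H) = c * mean N H"
  by (simp add: mean_def sum_distrib_left mult.left_commute)

lemma mean_order_ge: "order_ge (Suc N) H \<Longrightarrow> mean N H = 0"
  by (simp add: mean_def order_ge_def)

section \<open>Powers of \<open>x^2 + y^2\<close> and comparison of two series\<close>

definition circ :: fps2 where "circ = fps2_X ^ 2 + fps2_Y ^ 2"

lemma circ_power_nth:
  "circ ^ n $ i $ j = (if even i \<and> i + j = 2 * n then of_nat (n choose (i div 2)) else 0)"
proof -
  have "circ ^ n = (\<Sum>k\<le>n. of_nat (n choose k) * (fps2_X ^ 2) ^ k * (fps2_Y ^ 2) ^ (n - k))"
    unfolding circ_def by (rule binomial_ring)
  also have "\<dots> = (\<Sum>k\<le>n. scalar (of_nat (n choose k)) * (fps_X ^ (2 * k) * fps_const (fps_X ^ (2 * (n - k)))))"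
    by (simp add: scalar_of_nat fps2_X_def fps2_Y_def power_mult[symmetric] mult.assoc)
  finally have "circ ^ n $ i $ j = (\<Sum>k\<le>n. if i = 2 * k \<and> j = 2 * (n - k) then of_nat (n choose k) else 0)"
    by (simp add: fps_sum_nth fps_X_power_mult_nth cong: if_cong)
      (auto simp: fps_X_power_nth intro!: sum.cong)
  also have "\<dots> = (\<Sum>k\<le>n. if k = i div 2 then (if even i \<and> i + j = 2 * n then of_nat (n choose (i div 2)) else 0) else 0)"
    by (rule sum.cong) auto
  also have "\<dots> = (if even i \<and> i + j = 2 * n then of_nat (n choose (i div 2)) else 0)"
    by (auto simp: sum.delta)
  finally show ?thesis .
qed

text \<open>Moments and binomial coefficients are natural numbers, so nothing cancels, and the term
  of \<open>y^(2n)\<close> is positive.\<close>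

lemma mean_circ_power: "mean (2 * n) (circ ^ n) \<noteq> 0"
proof -
  have "mean (2 * n) (circ ^ n) = of_nat (\<Sum>i\<le>2*n. gauss_moment i * gauss_moment (2 * n - i) *
      (if even i then n choose (i div 2) else 0))"
    unfolding mean_def of_nat_sum by (intro sum.cong) (auto simp: circ_power_nth)
  moreover have "(\<Sum>i\<le>2*n. gauss_moment i * gauss_moment (2 * n - i) *
      (if even i then n choose (i div 2) else 0)) \<ge> gauss_moment 0 * gauss_moment (2 * n - 0) * (if even (0::nat) then n choose (0 div 2) else 0)"
    by (rule member_le_sum) auto
  ultimately show ?thesis using gauss_moment_pos[of "2 * n"] by (auto simp del: of_nat_sum)
qed

lemma focal_rhs_nth:
  "focal_rhs s $ i $ j = (if j = 0 then focal_gf s $ i else 0) + (if i = 0 then focal_gf s $ j else 0)"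
  by (simp add: focal_rhs_def)

text \<open>Since even moments are positive, the mean reads off the focal value belonging to an even
  degree.\<close>

lemma mean_focal_rhs:
  assumes "N > 0"
  shows "mean N (focal_rhs s) = 2 * of_nat (gauss_moment N) * focal_gf s $ N"
proof -
  have "mean N (focal_rhs s) =
    (\<Sum>i\<le>N. (if i = N then of_nat (gauss_moment N) * focal_gf s $ N else 0) +
           (if i = 0 then of_nat (gauss_moment N) * focal_gf s $ N else 0))"
    unfolding mean_def using assms by (intro sum.cong) (auto simp: focal_rhs_nth)
  also have "\<dots> = 2 * of_nat (gauss_moment N) * focal_gf s $ N"
    by (simp add: sum.distrib)
  finally show ?thesis .
qed

text \<open>If \<open>F - K\<close> has order \<open>N < 2 * n\<close>, taking means in degree
  \<open>N\<close> shows that \<open>focal_gf s\<close> has no term there. The leading part of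
  \<open>F - K\<close> is then annihilated by the rotation, and adding a multiple of a power of
  \<open>G\<close> to \<open>K\<close> removes it. In degree \<open>2 * n\<close> the mean of
  \<open>scalar c * circ ^ n\<close> is nonzero, and so is the focal value.\<close>

lemma first_focal_value:
  assumes PQ: "rotation_like P Q"
    and F: "order_ge 3 (F - circ)" "lie P Q F = focal_rhs s"
    and G: "order_ge 3 (G - circ)" "order_ge (2 * n + 1) (lie P Q G - scalar c * circ ^ n)"
    and c: "c \<noteq> 0" and n: "n \<ge> 2"
  shows "(\<forall>j\<in>{1..<n-1}. s j = 0) \<and> s (n - 1) \<noteq> 0"
proof -
  have circ2: "order_ge (2 * k) (circ ^ k)" for k
    by (auto simp: order_ge_def circ_power_nth)
  have G2: "order_ge 2 G"
    using order_ge_add[OF order_ge_mono[OF G(1)] circ2[of 1]] by simp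
  have Gpow: "order_ge (2 * k + 1) (G ^ k - circ ^ k)" for k
  proof (induction k)
    case (Suc k)
    have "G ^ Suc k - circ ^ Suc k = (G - circ) * circ ^ k + G * (G ^ k - circ ^ k)"
      by (simp add: algebra_simps)
    moreover have "order_ge (2 * Suc k + 1) ((G - circ) * circ ^ k)"
      using order_ge_mult[OF G(1) circ2[of k]] by (simp add: numeral_eq_Suc)
    moreover have "order_ge (2 * Suc k + 1) (G * (G ^ k - circ ^ k))"
      using order_ge_mult[OF G2 Suc] by simp
    ultimately show ?case by (simp add: order_ge_add)
  qed simp
  have "\<exists>K. order_ge N (F - K) \<and> order_ge (2 * n + 1) (lie P Q K - scalar c * circ ^ n) \<and>
      (\<forall>k<N. focal_gf s $ k = 0)" if "3 \<le> N" "N \<le> 2 * n" for N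
    using that
  proof (induction N rule: dec_induct)
    case base
    have "order_ge 3 (F - G)"
      using order_ge_diff[OF F(1) G(1)] by simp
    then show ?case using G(2) by (auto intro!: exI[of _ G] simp: focal_gf_def)
  next
    case (step N)
    then obtain K where K: "order_ge N (F - K)" "order_ge (2 * n + 1) (lie P Q K - scalar c * circ ^ n)"
      "\<forall>k<N. focal_gf s $ k = 0" by auto
    have "order_ge (2 * n) (lie P Q K)"
      using order_ge_add[OF order_ge_mono[OF K(2)] order_ge_mult_left[OF circ2[of n]], of "scalar c"] by simp
    then have lieK: "order_ge (Suc N) (lie P Q K)"
      by (rule order_ge_mono) (use step in simp)
    have "mean N (focal_rhs s) = mean N (lie P Q (F - K)) + mean N (lie P Q K)"
      by (simp add: lie_diff F(2) mean_diff)
    also have "\<dots> = 0"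
      using mean_lie[OF PQ K(1)] mean_order_ge[OF lieK] by simp
    finally have "gauss_moment N = 0 \<or> focal_gf s $ N = 0"
      using mean_focal_rhs[of N s] step.hyps by auto
    then have gf: "focal_gf s $ N = 0"
      using gauss_moment_pos[of N] by (cases "even N") (auto simp: focal_gf_def)
    \<comment> \<open>For even \<open>N\<close>, \<open>a\<close> is the multiple of
      \<open>circ ^ (N div 2)\<close> to be removed, read off at \<open>y^N\<close>; for odd
      \<open>N\<close> the rotation has no kernel.\<close>
    define a where "a = (if even N then (F - K) $ 0 $ N else 0)"
    define K' where "K' = K + scalar a * G ^ (N div 2)"
    have GN: "order_ge N (G ^ (N div 2))" "G ^ (N div 2) $ 0 $ N = 1" if "even N"
    proof -
      show "order_ge N (G ^ (N div 2))"
        using order_ge_power[OF G2, of "N div 2"] that by simp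
      have "(G ^ (N div 2) - circ ^ (N div 2)) $ 0 $ N = 0"
        by (rule order_geD[OF Gpow]) (use that in simp)
      then show "G ^ (N div 2) $ 0 $ N = 1"
        using that by (simp add: circ_power_nth)
    qed
    \<comment> \<open>The chain rule produces the factor \<open>G ^ (N div 2 - 1)\<close>. Its
      exponent is positive because an even \<open>N\<close> is at least 4 here, so the order exceeds
      \<open>2 * n\<close>.\<close>
    have lie_diff_K': "order_ge (2 * n + 1) (lie P Q (scalar a * G ^ (N div 2)))"
    proof -
      have "order_ge (2 * n) (lie P Q G)"
        using order_ge_add[OF order_ge_mono[OF G(2)] order_ge_mult_left[OF circ2[of n]], of "scalar c"] by simp
      moreover have "order_ge 1 (G ^ (N div 2 - 1))" if "even N"
        by (rule order_ge_mono[OF order_ge_power[OF G2, of "N div 2 - 1"]])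
          (use that step.hyps in presburger)
      ultimately have "order_ge (1 + 2 * n) (G ^ (N div 2 - 1) * lie P Q G)" if "even N"
        using that by (intro order_ge_mult)
      then have "order_ge (2 * n + 1) (scalar a * of_nat (N div 2) * (G ^ (N div 2 - 1) * lie P Q G))" if "even N"
        using that order_ge_mult_left[of "2 * n + 1" "G ^ (N div 2 - 1) * lie P Q G"] by simp
      then show ?thesis
        by (cases "even N") (simp_all add: lie_scalar_mult lie_power mult.assoc a_def)
    qed
    have "order_ge (Suc N) (F - K')"
    proof (rule lie_kernel[OF PQ])
      have "order_ge N (scalar a * G ^ (N div 2))"
        by (cases "even N") (auto simp: a_def intro!: order_ge_mult_left GN)
      from order_ge_diff[OF K(1) this] show "order_ge N (F - K')" by (simp add: K'_def algebra_simps)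
      show "odd N \<or> (F - K') $ 0 $ N = 0"
        by (auto simp: K'_def a_def GN scalar_def)
      fix i j assume ij: "i + j = N"
      have "lie P Q (F - K') = focal_rhs s - lie P Q K - lie P Q (scalar a * G ^ (N div 2))"
        by (simp add: lie_diff lie_add K'_def F(2) algebra_simps)
      moreover have "focal_rhs s $ i $ j = 0"
        using ij gf by (auto simp: focal_rhs_nth)
      moreover have "lie P Q K $ i $ j = 0"
        using ij by (intro order_geD[OF lieK]) simp
      moreover have "lie P Q (scalar a * G ^ (N div 2)) $ i $ j = 0"
        using ij step by (intro order_geD[OF lie_diff_K']) simp
      ultimately show "lie P Q (F - K') $ i $ j = 0" by simp
    qed
    moreover have "order_ge (2 * n + 1) (lie P Q K' - scalar c * circ ^ n)"
      using order_ge_add[OF K(2) lie_diff_K'] by (simp add: K'_def lie_add algebra_simps)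
    ultimately show ?case using K(3) gf by (auto intro!: exI[of _ K'] simp: less_Suc_eq)
  qed
  from this[of "2 * n"] n obtain K where K: "order_ge (2 * n) (F - K)"
    "order_ge (2 * n + 1) (lie P Q K - scalar c * circ ^ n)" "\<forall>k<2*n. focal_gf s $ k = 0" by auto
  have "s j = 0" if "j \<in> {1..<n-1}" for j
  proof -
    from that K(3) have "focal_gf s $ (2 * j + 2) = 0" by auto
    then show ?thesis using that by (simp add: focal_gf_def)
  qed
  moreover have "s (n - 1) \<noteq> 0"
  proof
    assume "s (n - 1) = 0"
    then have "mean (2 * n) (focal_rhs s) = 0"
      using n by (simp add: mean_focal_rhs focal_gf_def)
    moreover have "mean (2 * n) (lie P Q (F - K)) = 0"
      by (rule mean_lie[OF PQ K(1)])
    moreover have "mean (2 * n) (lie P Q K - scalar c * circ ^ n) = 0"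
      by (rule mean_order_ge) (use K(2) in simp)
    ultimately show False
      using c mean_circ_power[of n] by (simp add: lie_diff F(2) mean_diff mean_scalar_mult)
  qed
  ultimately show ?thesis by simp
qed

section \<open>A three-parameter family of cubic systems\<close>

text \<open>The coefficient of \<open>u\<^bsup>3i+1\<^esup> v\<^sup>j\<close> in the series \<open>G\<close>. For \<open>j = 3i+1 > 1\<close>, where the coefficient is
  free, it is set to the obstruction, the coefficient of \<open>(u v)\<^sup>j\<close> in the derivative of \<open>G\<close>.\<close>

fun integral_coeff :: "real \<Rightarrow> real \<Rightarrow> real \<Rightarrow> nat \<Rightarrow> nat \<Rightarrow> real" where
  "integral_coeff B C D i j =
     (if i = 0 \<and> j = 1 then 1 else
      ((real (3 * i + 1) + (real j - 1) * C) * (if j = 0 then 0 else integral_coeff B C D i (j - 1)) +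
       (real (3 * i + 1) * B + (real j - 2) * D) * (if j < 2 then 0 else integral_coeff B C D i (j - 2)) +
       real (j + 1) * (if i = 0 then 0 else integral_coeff B C D (i - 1) (j + 1))) /
      (if j = 3 * i + 1 then 1 else real j - real (3 * i + 1)))"

declare integral_coeff.simps [simp del]

lemma integral_coeff_00: "integral_coeff B C D 0 0 = 0"
  by (simp add: integral_coeff.simps)

lemma integral_coeff_01: "integral_coeff B C D 0 1 = 1"
  by (simp add: integral_coeff.simps)

text \<open>The left-hand side is the coefficient of \<open>u^(3i+1) v^j\<close> in the derivative
  of \<open>G\<close>, up to the factor \<open>- \<i>\<close>. Off the diagonal
  \<open>j = 3 * i + 1\<close> the division in the definition makes it zero. On the diagonal the
  first summand disappears, and for \<open>i > 0\<close> the rest is the stored obstruction.\<close>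

lemma integral_coeff_recursion:
  "(real (3 * i + 1) - real j) * integral_coeff B C D i j +
   (real (3 * i + 1) + (real j - 1) * C) * (if j = 0 then 0 else integral_coeff B C D i (j - 1)) +
   (real (3 * i + 1) * B + (real j - 2) * D) * (if j < 2 then 0 else integral_coeff B C D i (j - 2)) +
   real (j + 1) * (if i = 0 then 0 else integral_coeff B C D (i - 1) (j + 1)) =
   (if j = 3 * i + 1 \<and> i > 0 then integral_coeff B C D i j else 0)" (is "?a + ?b + ?c + ?d = _")
proof (cases "i = 0 \<and> j = 1")
  case True
  then show ?thesis by (simp add: integral_coeff_00)
next
  case False
  have rec: "integral_coeff B C D i j = (?b + ?c + ?d) / (if j = 3 * i + 1 then 1 else real j - real (3 * i + 1))"
    unfolding integral_coeff.simps[of B C D i j] if_not_P[OF False] ..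
  show ?thesis
  proof (cases "j = 3 * i + 1")
    case True
    then have "?a = 0" "i > 0" using False by auto
    then show ?thesis using rec True by simp
  next
    case neq: False
    then have "real j - real (3 * i + 1) \<noteq> 0" by linarith
    then have "?b + ?c + ?d = (real j - real (3 * i + 1)) * integral_coeff B C D i j"
      using rec neq by simp
    then show ?thesis using neq by (simp add: algebra_simps)
  qed
qed

section \<open>The coordinates \<open>u\<close>, \<open>v\<close> and homogeneous monomials in
  them\<close>

definition fps2_u :: fps2 where "fps2_u = fps2_X + scalar \<i> * fps2_Y"
definition fps2_v :: fps2 where "fps2_v = fps2_X - scalar \<i> * fps2_Y"

lemma scalar_i_square: "scalar \<i> * scalar \<i> = - 1"
  by (simp add: scalar_mult[symmetric] scalar_minus)

lemma fps2_u_mult_v: "fps2_u * fps2_v = circ"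
proof -
  have "fps2_u * fps2_v = fps2_X ^ 2 - (scalar \<i> * scalar \<i>) * fps2_Y ^ 2"
    by (simp add: fps2_u_def fps2_v_def algebra_simps power2_eq_square)
  then show ?thesis by (simp add: scalar_i_square circ_def)
qed

definition homogeneous :: "nat \<Rightarrow> fps2 \<Rightarrow> bool" where
  "homogeneous k H \<longleftrightarrow> (\<forall>i j. H $ i $ j \<noteq> 0 \<longrightarrow> i + j = k)"

lemma homogeneous_mult:
  assumes "homogeneous k H" "homogeneous l K"
  shows "homogeneous (k + l) (H * K)"
  unfolding homogeneous_def
proof (intro allI impI)
  fix i j
  assume "(H * K) $ i $ j \<noteq> 0"
  then obtain a where a: "a \<in> {0..i}" "(\<Sum>b=0..j. H $ a $ b * K $ (i - a) $ (j - b)) \<noteq> 0"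
    unfolding fps2_mult_nth by (rule sum.not_neutral_contains_not_neutral)
  from a(2) obtain b where b: "b \<in> {0..j}" "H $ a $ b * K $ (i - a) $ (j - b) \<noteq> 0"
    by (rule sum.not_neutral_contains_not_neutral)
  then have "a + b = k" "(i - a) + (j - b) = l"
    using assms unfolding homogeneous_def by (metis mult_eq_0_iff)+
  then show "i + j = k + l" using a(1) b(1) by auto
qed

lemma homogeneous_u: "homogeneous 1 fps2_u" and homogeneous_v: "homogeneous 1 fps2_v"
  by (auto simp: homogeneous_def fps2_u_def fps2_v_def fps2_X_def fps2_Y_def scalar_def fps_X_def split: if_splits)

lemma homogeneous_power: "homogeneous k H \<Longrightarrow> homogeneous (n * k) (H ^ n)"
proof (induction n)
  case 0
  then show ?case by (auto simp: homogeneous_def fps_one_def split: if_splits)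
next
  case (Suc n)
  then show ?case by (auto dest: homogeneous_mult)
qed

lemma homogeneous_monomial: "homogeneous (m + j) (fps2_u ^ m * fps2_v ^ j)"
  using homogeneous_mult[OF homogeneous_power[OF homogeneous_u, of m] homogeneous_power[OF homogeneous_v, of j]]
  by simp

lemma order_ge_homogeneous: "homogeneous k H \<Longrightarrow> N \<le> k \<Longrightarrow> order_ge N H"
  by (force simp: homogeneous_def order_ge_def)

lemma order_ge_monomial: "N \<le> m + j \<Longrightarrow> order_ge N (fps2_u ^ m * fps2_v ^ j)"
  by (rule order_ge_homogeneous[OF homogeneous_monomial])

text \<open>Serves to collect truncated sums by monomials: re-indexing leaves only the term at the
  cut-off unmatched, and its order is at least \<open>N\<close>.\<close>

lemma shift_sum:
  assumes "order_ge N (E n)"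
  shows "order_ge N ((\<Sum>j<n. scalar (f j) * E (Suc j)) - (\<Sum>j<n. scalar (if j = 0 then 0 else f (j - 1)) * E j))"
proof (cases n)
  case (Suc k)
  have "(\<Sum>j<n. scalar (f j) * E (Suc j)) - (\<Sum>j<n. scalar (if j = 0 then 0 else f (j - 1)) * E j)
      = scalar (f k) * E n"
    unfolding Suc sum.lessThan_Suc[of "\<lambda>j. scalar (f j) * E (Suc j)"] sum.lessThan_Suc_shift[of "\<lambda>j. scalar (if j = 0 then 0 else f (j - 1)) * E j"]
    by simp
  then show ?thesis using order_ge_mult_left[OF assms] by simp
qed simp

lemma shift_sum_two:
  assumes "order_ge N (E n)" "order_ge N (E (Suc n))"
  shows "order_ge N ((\<Sum>j<n. scalar (f j) * E (j + 2)) - (\<Sum>j<n. scalar (if j < 2 then 0 else f (j - 2)) * E j))"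
proof -
  let ?g = "\<lambda>j. if j = 0 then 0 else f (j - 1)"
  have "order_ge N ((\<Sum>j<n. scalar (f j) * E (Suc (Suc j))) - (\<Sum>j<n. scalar (?g j) * E (Suc j)))"
    by (rule shift_sum) (fact assms(2))
  moreover have "order_ge N ((\<Sum>j<n. scalar (?g j) * E (Suc j)) - (\<Sum>j<n. scalar (if j = 0 then 0 else ?g (j - 1)) * E j))"
    by (rule shift_sum) (fact assms(1))
  moreover have "(if j = 0 then 0 else ?g (j - 1)) = (if j < 2 then 0 else f (j - 2))" for j
    by (auto simp: numeral_2_eq_2)
  ultimately show ?thesis
    using order_ge_add by fastforce
qed

text \<open>Natural subtraction turns \<open>E (j - 1)\<close> into a second \<open>E 0\<close> at
  \<open>j = 0\<close>; the assumption \<open>f 0 = 0\<close> removes it.\<close>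

lemma shift_sum_back:
  assumes "order_ge N (E (n - 1))" "f 0 = 0"
  shows "order_ge N ((\<Sum>j<n. scalar (f j) * E (j - 1)) - (\<Sum>j<n. scalar (f (Suc j)) * E j))"
proof (cases n)
  case (Suc k)
  have eq: "(\<Sum>j<n. scalar (f j) * E (j - 1)) - (\<Sum>j<n. scalar (f (Suc j)) * E j) =
      - (scalar (f (Suc k)) * E (n - 1))"
    unfolding Suc sum.lessThan_Suc_shift[of "\<lambda>j. scalar (f j) * E (j - 1)"]
      sum.lessThan_Suc[of "\<lambda>j. scalar (f (Suc j)) * E j"]
    using assms(2) by simp
  show ?thesis unfolding eq by (rule order_ge_minus[OF order_ge_mult_left[OF assms(1)]])
qed simp

lemma order_ge_sum_diff:
  "(\<And>x. x \<in> A \<Longrightarrow> order_ge N (f x - g x)) \<Longrightarrow> order_ge N (sum f A - sum g A)"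
  unfolding sum_subtractf[symmetric] by (rule order_ge_sum)

lemma order_ge_double_sum_diff:
  fixes a b I J :: nat
  assumes "a < I" "b < J" "\<And>i j. i < I \<Longrightarrow> j < J \<Longrightarrow> (i, j) \<noteq> (a, b) \<Longrightarrow> order_ge N (t i j)"
  shows "order_ge N ((\<Sum>i<I. \<Sum>j<J. t i j) - t a b)"
proof -
  have "(\<Sum>i<I. \<Sum>j<J. t i j) - t a b = sum (case_prod t) ({..<I} \<times> {..<J}) - case_prod t (a, b)"
    by (simp add: sum.cartesian_product)
  also have "\<dots> = sum (case_prod t) ({..<I} \<times> {..<J} - {(a, b)})"
    using assms(1,2) by (subst sum_diff1) auto
  also have "order_ge N \<dots>"
    using assms(3) by (intro order_ge_sum) auto
  finally show ?thesis .
qed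

section \<open>The series \<open>G\<close> and its derivative along a system of the family\<close>

locale cubic_system =
  fixes B C D :: real and P Q :: fps2
  assumes lie_u: "lie P Q fps2_u =
      scalar (- \<i>) * (fps2_u * (1 + fps2_v + scalar B * fps2_v ^ 2))"
    and lie_v: "lie P Q fps2_v =
      scalar (- \<i>) * (- fps2_v + scalar C * fps2_v ^ 2 + scalar D * fps2_v ^ 3 + fps2_u ^ 3)"
begin

abbreviation \<beta> :: "nat \<Rightarrow> nat \<Rightarrow> complex" where
  "\<beta> i j \<equiv> complex_of_real (integral_coeff B C D i j)"

abbreviation monomial :: "nat \<Rightarrow> nat \<Rightarrow> fps2" where
  "monomial i j \<equiv> fps2_u ^ (3 * i + 1) * fps2_v ^ j"

text \<open>The ranges contain every \<open>u^(3i+1) v^j\<close> of degree below 27, and terms of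
  the derivative that leave them have degree at least 27. The obstruction stored at
  \<open>(4, 13)\<close> multiplies \<open>(u v)^13\<close>, which the rotation annihilates, so it
  affects the derivative only from degree 27 on.\<close>

definition first_integral :: fps2 where
  "first_integral = (\<Sum>i<9. \<Sum>j<27. scalar (\<beta> i j) * monomial i j)"

lemma lie_monomial:
  "lie P Q (fps2_u ^ m * fps2_v ^ j) = scalar (- \<i>) *
     (scalar (of_nat m - of_nat j) * (fps2_u ^ m * fps2_v ^ j) +
      scalar (of_nat m + of_nat j * C) * (fps2_u ^ m * fps2_v ^ Suc j) +
      scalar (of_nat m * B + of_nat j * D) * (fps2_u ^ m * fps2_v ^ (j + 2)) +
      scalar (of_nat j) * (fps2_u ^ (m + 3) * fps2_v ^ (j - 1)))"
proof -
  have u: "of_nat m * fps2_u ^ (m - 1) * (fps2_u * K) = of_nat m * fps2_u ^ m * K" for K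
    by (cases m) (simp_all add: algebra_simps)
  have v: "of_nat j * fps2_v ^ (j - 1) * (- fps2_v + scalar C * fps2_v ^ 2 + scalar D * fps2_v ^ 3 + fps2_u ^ 3) =
     of_nat j * (- (fps2_v ^ j) + scalar C * fps2_v ^ Suc j + scalar D * fps2_v ^ (j + 2) + fps2_v ^ (j - 1) * fps2_u ^ 3)"
    by (cases j) (simp_all add: algebra_simps power2_eq_square power3_eq_cube)
  have "lie P Q (fps2_u ^ m * fps2_v ^ j) =
     scalar (- \<i>) * (of_nat m * fps2_u ^ (m - 1) * (fps2_u * (1 + fps2_v + scalar B * fps2_v ^ 2)) * fps2_v ^ j +
      fps2_u ^ m * (of_nat j * fps2_v ^ (j - 1) * (- fps2_v + scalar C * fps2_v ^ 2 + scalar D * fps2_v ^ 3 + fps2_u ^ 3)))"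
    by (simp add: lie_mult lie_power lie_u lie_v algebra_simps)
  also have "\<dots> = scalar (- \<i>) *
     ((of_nat m - of_nat j) * (fps2_u ^ m * fps2_v ^ j) +
      (of_nat m + of_nat j * scalar C) * (fps2_u ^ m * fps2_v ^ Suc j) +
      (of_nat m * scalar B + of_nat j * scalar D) * (fps2_u ^ m * fps2_v ^ (j + 2)) +
      of_nat j * (fps2_u ^ (m + 3) * fps2_v ^ (j - 1)))"
    unfolding u v by (simp add: algebra_simps power_add power2_eq_square)
  finally show ?thesis by (simp add: scalar_add scalar_diff scalar_mult scalar_of_nat)
qed

lemma integral_leading: "order_ge 3 (first_integral - circ)"
proof -
  have "order_ge 3 (first_integral - scalar (\<beta> 0 1) * monomial 0 1)"
    unfolding first_integral_def
  proof (rule order_ge_double_sum_diff)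
    fix i j :: nat
    assume "(i, j) \<noteq> (0, 1)"
    then have "i = 0 \<and> j = 0 \<or> 3 \<le> 3 * i + 1 + j" by auto
    then show "order_ge 3 (scalar (\<beta> i j) * monomial i j)"
    proof
      assume "i = 0 \<and> j = 0"
      then show ?thesis by (simp add: integral_coeff_00)
    qed (intro order_ge_mult_left order_ge_monomial)
  qed auto
  then show ?thesis by (simp add: integral_coeff_01[simplified] fps2_u_mult_v)
qed

text \<open>Up to order 27 the derivative can be collected by monomials. By
  \<open>integral_coeff_recursion\<close> only the obstructions on the diagonal survive, three of
  which are assumed to vanish.\<close>

lemma lie_integral:
  assumes "integral_coeff B C D 1 4 = 0" "integral_coeff B C D 2 7 = 0" "integral_coeff B C D 3 10 = 0"
  shows "order_ge 27 (lie P Q first_integral - scalar (- \<i> * \<beta> 4 13) * circ ^ 13)"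
proof -
  define m :: "nat \<Rightarrow> complex" where "m = (\<lambda>i. of_nat (3 * i + 1))"
  define T1 where "T1 = (\<Sum>i<9. \<Sum>j<27. scalar ((m i - of_nat j) * \<beta> i j) * monomial i j)"
  define T2 where "T2 = (\<Sum>i<9. \<Sum>j<27. scalar ((m i + of_nat j * C) * \<beta> i j) * monomial i (Suc j))"
  define T3 where "T3 = (\<Sum>i<9. \<Sum>j<27. scalar ((m i * B + of_nat j * D) * \<beta> i j) * monomial i (j + 2))"
  define T4 where "T4 = (\<Sum>i<9. \<Sum>j<27. scalar (of_nat j * \<beta> i j) * monomial (Suc i) (j - 1))"
  \<comment> \<open>\<open>S2\<close>, \<open>S3\<close>, \<open>S4\<close> are \<open>T2\<close>,
    \<open>T3\<close>, \<open>T4\<close> collected by \<open>monomial i j\<close>, up to order 27;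
    \<open>S4'\<close> is the halfway stage in which only \<open>j\<close> is shifted.\<close>
  define S2 where "S2 = (\<Sum>i<9. \<Sum>j<27. scalar (if j = 0 then 0 else (m i + of_nat (j - 1) * C) * \<beta> i (j - 1)) * monomial i j)"
  define S3 where "S3 = (\<Sum>i<9. \<Sum>j<27. scalar (if j < 2 then 0 else (m i * B + of_nat (j - 2) * D) * \<beta> i (j - 2)) * monomial i j)"
  define S4' where "S4' = (\<Sum>i<9. \<Sum>j<27. scalar (of_nat (Suc j) * \<beta> i (Suc j)) * monomial (Suc i) j)"
  define S4 where "S4 = (\<Sum>i<9. \<Sum>j<27. scalar (if i = 0 then 0 else of_nat (Suc j) * \<beta> (i - 1) (Suc j)) * monomial i j)"
  have "lie P Q first_integral = scalar (- \<i>) * (T1 + T2 + T3 + T4)"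
  proof -
    have ring: "k * (c * (a1 * m1 + a2 * m2 + a3 * m3 + a4 * m4)) =
        c * (a1 * k * m1) + c * (a2 * k * m2) + c * (a3 * k * m3) + c * (a4 * k * m4)"
      for c k a1 a2 a3 a4 m1 m2 m3 m4 :: fps2
      by (simp add: algebra_simps)
    have exponent: "3 * Suc i + 1 = 3 * i + 1 + 3" for i :: nat by simp
    have "lie P Q (scalar (\<beta> i j) * monomial i j) =
         scalar (- \<i>) * (scalar ((m i - of_nat j) * \<beta> i j) * monomial i j) +
         scalar (- \<i>) * (scalar ((m i + of_nat j * C) * \<beta> i j) * monomial i (Suc j)) +
         scalar (- \<i>) * (scalar ((m i * B + of_nat j * D) * \<beta> i j) * monomial i (j + 2)) +
         scalar (- \<i>) * (scalar (of_nat j * \<beta> i j) * monomial (Suc i) (j - 1))" for i j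
      unfolding lie_scalar_mult lie_monomial ring m_def exponent scalar_mult
      by (simp only: of_real_add of_real_mult of_real_of_nat_eq)
    then show ?thesis
      by (simp only: first_integral_def lie_sum T1_def T2_def T3_def T4_def distrib_left sum_distrib_left sum.distrib)
  qed
  moreover have "order_ge 27 (T2 - S2)"
    unfolding T2_def S2_def by (rule order_ge_sum_diff, rule shift_sum, rule order_ge_monomial) simp
  moreover have "order_ge 27 (T3 - S3)"
    unfolding T3_def S3_def
    by (rule order_ge_sum_diff, rule shift_sum_two; rule order_ge_monomial) simp_all
  moreover have "order_ge 27 (T4 - S4')"
    unfolding T4_def S4'_def
    by (rule order_ge_sum_diff, rule shift_sum_back, rule order_ge_monomial) simp_all
  moreover have "order_ge 27 (S4' - S4)"
    \<comment> \<open>With the summations exchanged, \<open>shift_sum\<close> acts on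
      \<open>i\<close>.\<close>
    unfolding S4'_def S4_def sum.swap[of _ "{..<27::nat}" "{..<9::nat}"]
    by (rule order_ge_sum_diff, rule shift_sum, rule order_ge_monomial) simp
  moreover have "order_ge 27 (T1 + S2 + S3 + S4 - scalar (\<beta> 4 13) * circ ^ 13)"
  proof -
    define K where "K = (\<lambda>i j. if j = 3 * i + 1 \<and> i > 0 then \<beta> i j else 0)"
    have "T1 + S2 + S3 + S4 = (\<Sum>i<9. \<Sum>j<27. scalar (K i j) * monomial i j)"
      unfolding T1_def S2_def S3_def S4_def sum.distrib[symmetric] distrib_right[symmetric] scalar_add[symmetric]
    proof (intro sum.cong refl arg_cong2[of _ _ _ _ "(*)"] arg_cong[of _ _ scalar])
      fix i j :: nat
      have "complex_of_real ((real (3 * i + 1) - real j) * integral_coeff B C D i j +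
         (real (3 * i + 1) + (real j - 1) * C) * (if j = 0 then 0 else integral_coeff B C D i (j - 1)) +
         (real (3 * i + 1) * B + (real j - 2) * D) * (if j < 2 then 0 else integral_coeff B C D i (j - 2)) +
         real (j + 1) * (if i = 0 then 0 else integral_coeff B C D (i - 1) (j + 1))) = K i j"
        unfolding integral_coeff_recursion K_def by simp
      moreover have "(if j = 0 then 0 else (m i + of_nat (j - 1) * C) * \<beta> i (j - 1)) =
          complex_of_real ((real (3 * i + 1) + (real j - 1) * C) * (if j = 0 then 0 else integral_coeff B C D i (j - 1)))"
        by (cases j) (simp_all add: m_def)
      moreover have "(if j < 2 then 0 else (m i * B + of_nat (j - 2) * D) * \<beta> i (j - 2)) =
          complex_of_real ((real (3 * i + 1) * B + (real j - 2) * D) * (if j < 2 then 0 else integral_coeff B C D i (j - 2)))"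
        by (simp add: m_def of_nat_diff)
      moreover have "(if i = 0 then 0 else of_nat (Suc j) * \<beta> (i - 1) (Suc j)) =
          complex_of_real (real (j + 1) * (if i = 0 then 0 else integral_coeff B C D (i - 1) (j + 1)))"
        by simp
      moreover have "(m i - of_nat j) * \<beta> i j = complex_of_real ((real (3 * i + 1) - real j) * integral_coeff B C D i j)"
        by (simp add: m_def)
      ultimately show "(m i - of_nat j) * \<beta> i j +
          (if j = 0 then 0 else (m i + of_nat (j - 1) * C) * \<beta> i (j - 1)) +
          (if j < 2 then 0 else (m i * B + of_nat (j - 2) * D) * \<beta> i (j - 2)) +
          (if i = 0 then 0 else of_nat (Suc j) * \<beta> (i - 1) (Suc j)) = K i j"
        by (simp only: of_real_add)
    qed
    moreover have "order_ge 27 ((\<Sum>i<9. \<Sum>j<27. scalar (K i j) * monomial i j) - scalar (K 4 13) * monomial 4 13)"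
    proof (rule order_ge_double_sum_diff)
      fix i j :: nat
      assume "(i, j) \<noteq> (4, 13)"
      \<comment> \<open>The diagonal monomials have degree \<open>6 * i + 2\<close>, which is below
        27 only up to \<open>i = 4\<close>.\<close>
      then have "\<not> (j = 3 * i + 1 \<and> i > 0) \<or> i = 1 \<and> j = 4 \<or> i = 2 \<and> j = 7 \<or> i = 3 \<and> j = 10 \<or> 27 \<le> 3 * i + 1 + j"
        by auto
      then have "K i j = 0 \<or> 27 \<le> 3 * i + 1 + j"
        using assms by (auto simp: K_def)
      then show "order_ge 27 (scalar (K i j) * monomial i j)"
      proof
        assume "K i j = 0"
        then show ?thesis by simp
      qed (intro order_ge_mult_left order_ge_monomial)
    qed auto
    moreover have "monomial 4 13 = circ ^ 13"
      by (simp add: power_mult_distrib[symmetric] fps2_u_mult_v)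
    moreover have "K 4 13 = \<beta> 4 13" by (simp add: K_def)
    ultimately show ?thesis by simp
  qed
  ultimately have "order_ge 27 ((T2 - S2) + (T3 - S3) + (T4 - S4') + (S4' - S4) +
      (T1 + S2 + S3 + S4 - scalar (\<beta> 4 13) * circ ^ 13))"
    by (intro order_ge_add)
  then have "order_ge 27 (scalar (- \<i>) * (T1 + T2 + T3 + T4 - scalar (\<beta> 4 13) * circ ^ 13))"
    by (intro order_ge_mult_left) (simp add: algebra_simps)
  then show ?thesis
    using \<open>lie P Q first_integral = _\<close> by (simp only: scalar_mult right_diff_distrib mult.assoc)
qed

end

section \<open>The systems of the family as polynomials \<open>p\<close>, \<open>q\<close>\<close>

lemma fps2_of_poly2_nth: "fps2_of_poly2 p $ i $ j = coeff (coeff p i) j"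
  by (simp add: fps2_of_poly2_def coeff_map_poly)

lemma fps2_of_poly2_add: "fps2_of_poly2 (p + q) = fps2_of_poly2 p + fps2_of_poly2 q"
  by (simp add: fps_eq_iff fps2_of_poly2_nth)

lemma fps2_of_poly2_diff: "fps2_of_poly2 (p - q) = fps2_of_poly2 p - fps2_of_poly2 q"
  by (simp add: fps_eq_iff fps2_of_poly2_nth)

lemma fps2_of_poly2_mult: "fps2_of_poly2 (p * q) = fps2_of_poly2 p * fps2_of_poly2 q"
  by (simp add: fps_eq_iff fps2_of_poly2_nth fps2_mult_nth coeff_mult coeff_sum atLeast0AtMost)

lemma fps2_of_poly2_power: "fps2_of_poly2 (p ^ n) = fps2_of_poly2 p ^ n"
proof (induction n)
  case 0
  show ?case by (auto simp: fps_eq_iff fps2_of_poly2_nth coeff_1)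
qed (simp add: fps2_of_poly2_mult)

definition poly2_const :: "complex \<Rightarrow> poly2" where "poly2_const c = [:[:c:]:]"

lemma fps2_of_poly2_const: "fps2_of_poly2 (poly2_const c) = scalar c"
  by (auto simp: fps_eq_iff fps2_of_poly2_nth scalar_def poly2_const_def coeff_pCons split: nat.splits)

lemma fps2_of_poly2_X2: "fps2_of_poly2 X2 = fps2_X"
  by (auto simp: fps_eq_iff fps2_of_poly2_nth X2_def fps2_X_def fps_X_def coeff_1)

lemma fps2_of_poly2_Y2: "fps2_of_poly2 Y2 = fps2_Y"
  by (auto simp: fps_eq_iff fps2_of_poly2_nth Y2_def fps2_Y_def fps_X_def coeff_pCons split: nat.splits)

lemma nonlinear_part_iff:
  "nonlinear_part d p \<longleftrightarrow> (\<forall>i j. fps2_of_poly2 p $ i $ j \<noteq> 0 \<longrightarrow> 2 \<le> i + j \<and> i + j \<le> d)"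
  by (simp add: nonlinear_part_def fps2_of_poly2_nth)

definition poly2_u :: poly2 where "poly2_u = X2 + poly2_const \<i> * Y2"
definition poly2_v :: poly2 where "poly2_v = X2 - poly2_const \<i> * Y2"

text \<open>The nonlinear parts in \<open>u' = - i (u + u_part B)\<close> and
  \<open>v' = - i (- v + v_part C D)\<close>.\<close>

definition u_part :: "real \<Rightarrow> poly2" where
  "u_part B = poly2_u * (poly2_v + poly2_const B * poly2_v ^ 2)"
definition v_part :: "real \<Rightarrow> real \<Rightarrow> poly2" where
  "v_part C D = poly2_const C * poly2_v ^ 2 + poly2_const D * poly2_v ^ 3 + poly2_u ^ 3"

text \<open>Obtained by solving \<open>u' = Q - i P\<close>, \<open>v' = Q + i P\<close> for
  \<open>P\<close> and \<open>Q\<close>.\<close>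

definition cubic_p :: "real \<Rightarrow> real \<Rightarrow> real \<Rightarrow> poly2" where
  "cubic_p B C D = poly2_const (1 / 2) * (u_part B - v_part C D)"
definition cubic_q :: "real \<Rightarrow> real \<Rightarrow> real \<Rightarrow> poly2" where
  "cubic_q B C D = poly2_const (- \<i> / 2) * (u_part B + v_part C D)"

lemmas fps2_of_poly2_simps = fps2_of_poly2_add fps2_of_poly2_diff fps2_of_poly2_mult
  fps2_of_poly2_power fps2_of_poly2_const fps2_of_poly2_X2 fps2_of_poly2_Y2

lemma fps2_of_poly2_u_part:
  "fps2_of_poly2 (u_part B) = fps2_u * fps2_v + scalar B * (fps2_u * fps2_v ^ 2)"
  unfolding u_part_def poly2_u_def poly2_v_def fps2_of_poly2_simps
    fps2_u_def[symmetric] fps2_v_def[symmetric] by (simp add: algebra_simps)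

lemma fps2_of_poly2_v_part:
  "fps2_of_poly2 (v_part C D) = scalar C * fps2_v ^ 2 + scalar D * fps2_v ^ 3 + fps2_u ^ 3"
  by (simp add: v_part_def poly2_u_def poly2_v_def fps2_of_poly2_simps
      fps2_u_def[symmetric] fps2_v_def[symmetric])

lemma nonlinear_part_cubic: "nonlinear_part 3 (cubic_p B C D)" "nonlinear_part 3 (cubic_q B C D)"
proof -
  have zero: "H $ i $ j = 0" if "homogeneous k H" "k = 2 \<or> k = 3" "\<not> (2 \<le> i + j \<and> i + j \<le> 3)" for H i j k
    using that unfolding homogeneous_def by fastforce
  have "(fps2_u * fps2_v) $ i $ j = 0" "(fps2_u * fps2_v ^ 2) $ i $ j = 0" "(fps2_v ^ 2) $ i $ j = 0"
    "(fps2_v ^ 3) $ i $ j = 0" "(fps2_u ^ 3) $ i $ j = 0" if "\<not> (2 \<le> i + j \<and> i + j \<le> 3)" for i j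
    using zero[OF homogeneous_monomial[of 1 1] _ that] zero[OF homogeneous_monomial[of 1 2] _ that]
      zero[OF homogeneous_monomial[of 0 2] _ that] zero[OF homogeneous_monomial[of 0 3] _ that]
      zero[OF homogeneous_monomial[of 3 0] _ that] by (simp_all add: numeral_eq_Suc)
  then have "fps2_of_poly2 (u_part B) $ i $ j = 0" "fps2_of_poly2 (v_part C D) $ i $ j = 0"
    if "\<not> (2 \<le> i + j \<and> i + j \<le> 3)" for i j
    using that unfolding fps2_of_poly2_u_part fps2_of_poly2_v_part fps_add_nth scalar_mult_nth by simp_all
  then show "nonlinear_part 3 (cubic_p B C D)" "nonlinear_part 3 (cubic_q B C D)"
    unfolding nonlinear_part_iff cubic_p_def cubic_q_def fps2_of_poly2_simps scalar_mult_nth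
      fps_add_nth fps_sub_nth by (metis add_0 diff_0_right mult_zero_right)+
qed

lemma order_ge_nonlinear_part: "nonlinear_part d p \<Longrightarrow> order_ge 2 (fps2_of_poly2 p)"
  unfolding nonlinear_part_iff order_ge_def by force

lemma rotation_like_nonlinear:
  "nonlinear_part d p \<Longrightarrow> nonlinear_part d q \<Longrightarrow>
    rotation_like (fps2_of_poly2 (X2 + p)) (fps2_of_poly2 (Y2 + q))"
  by (simp add: rotation_like_def fps2_of_poly2_simps order_ge_nonlinear_part)

lemma lie_linear:
  "lie P Q (fps2_X + scalar c * fps2_Y) = Q - scalar c * P"
proof -
  have "deriv_x fps2_X = 1" "deriv_y fps2_X = 0" "deriv_x fps2_Y = 0" "deriv_y fps2_Y = 1"
    by (auto simp: fps_eq_iff deriv_x_nth deriv_y_nth fps2_X_def fps2_Y_def fps_X_def fps_one_def)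
  then show ?thesis by (simp add: lie_def deriv_x_add deriv_y_add deriv_x_mult deriv_y_mult)
qed

lemma cubic_system_cubic:
  "cubic_system B C D (fps2_of_poly2 (X2 + cubic_p B C D)) (fps2_of_poly2 (Y2 + cubic_q B C D))"
proof
  let ?P = "fps2_of_poly2 (X2 + cubic_p B C D)" and ?Q = "fps2_of_poly2 (Y2 + cubic_q B C D)"
  let ?U = "fps2_of_poly2 (u_part B)" and ?V = "fps2_of_poly2 (v_part C D)"
  have P: "?P = fps2_X + scalar (1 / 2) * (?U - ?V)" and Q: "?Q = fps2_Y + scalar (- \<i> / 2) * (?U + ?V)"
    by (simp_all add: cubic_p_def cubic_q_def fps2_of_poly2_simps)
  have half: "H = scalar (1 / 2) * H + scalar (1 / 2) * H" for H
    by (simp add: distrib_right[symmetric] scalar_add[symmetric])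
  \<comment> \<open>Writing the scalars as multiples of \<open>scalar (\<i> / 2)\<close> leaves
    identities that ring normalisation settles.\<close>
  have split: "scalar \<i> * scalar (1 / 2) = scalar (\<i> / 2)" "scalar (- \<i> / 2) = - scalar (\<i> / 2)"
    "scalar (- \<i>) = - (scalar (\<i> / 2) + scalar (\<i> / 2))" "scalar \<i> = scalar (\<i> / 2) + scalar (\<i> / 2)"
    by (simp_all add: scalar_mult[symmetric] scalar_add[symmetric] scalar_minus[symmetric])
  have iY: "scalar \<i> * (scalar \<i> * fps2_Y) = - fps2_Y"
    by (simp add: mult.assoc[symmetric] scalar_i_square)
  have "lie ?P ?Q fps2_u = ?Q - scalar \<i> * ?P"
    unfolding fps2_u_def by (rule lie_linear)
  also have "\<dots> = scalar (- \<i>) * (fps2_u + ?U)"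
  proof -
    have "scalar (- \<i>) * fps2_u = fps2_Y - scalar \<i> * fps2_X"
      using iY by (simp add: fps2_u_def scalar_minus algebra_simps)
    moreover have "scalar (- \<i> / 2) * (?U + ?V) - (scalar \<i> * scalar (1 / 2)) * (?U - ?V) = scalar (- \<i>) * ?U"
      unfolding split(1-3) by (simp add: algebra_simps)
    ultimately show ?thesis unfolding P Q by (simp add: algebra_simps)
  qed
  finally show "lie ?P ?Q fps2_u = scalar (- \<i>) * (fps2_u * (1 + fps2_v + scalar B * fps2_v ^ 2))"
    by (simp add: fps2_of_poly2_u_part algebra_simps)
  have "lie ?P ?Q fps2_v = ?Q + scalar \<i> * ?P"
    using lie_linear[of ?P ?Q "- \<i>"] by (simp add: fps2_v_def scalar_minus)
  also have "\<dots> = scalar (- \<i>) * (- fps2_v + ?V)"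
  proof -
    have "scalar (- \<i>) * fps2_v = - fps2_Y - scalar \<i> * fps2_X"
      using iY by (simp add: fps2_v_def scalar_minus algebra_simps)
    moreover have "scalar (- \<i> / 2) * (?U + ?V) + (scalar \<i> * scalar (1 / 2)) * (?U - ?V) = scalar (- \<i>) * ?V"
      unfolding split(1-3) by (simp add: algebra_simps)
    ultimately show ?thesis unfolding P Q by (simp add: algebra_simps)
  qed
  finally show "lie ?P ?Q fps2_v = scalar (- \<i>) * (- fps2_v + scalar C * fps2_v ^ 2 + scalar D * fps2_v ^ 3 + fps2_u ^ 3)"
    by (simp add: fps2_of_poly2_v_part algebra_simps)
qed

lemma focal_equation_leading: "focal_equation p q F s \<Longrightarrow> order_ge 3 (F - circ)"
proof -
  assume eq: "focal_equation p q F s"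
  have "(F - circ) $ i $ j = 0" if "i + j < 3" for i j
  proof -
    have "circ $ i $ j = (if even i \<and> i + j = 2 then of_nat (1 choose (i div 2)) else 0)"
      using circ_power_nth[of 1 i j] by simp
    moreover have "F $ i $ j = (if (i, j) \<in> {(2, 0), (0, 2)} then 1 else 0)"
      using eq that unfolding focal_equation_def by (metis less_Suc_eq_le numeral_2_eq_2 numeral_3_eq_3)
    moreover have "i = 0 \<or> i = 1 \<or> i = 2" using that by auto
    ultimately show ?thesis by auto
  qed
  then show ?thesis by (simp add: order_ge_def)
qed

section \<open>Existence of suitable parameters\<close>

text \<open>Zeros of \<open>f\<close> are fixed points of \<open>h - f h\<close>. This map sends the
  box into itself once \<open>f\<close> is close enough to the identity there.\<close>

lemma zero_near_identity:
  fixes f :: "'a::euclidean_space \<Rightarrow> 'a"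
  assumes "continuous_on (cbox a b) f" "0 \<in> cbox a b" "\<And>h. h \<in> cbox a b \<Longrightarrow> h - f h \<in> cbox a b"
  obtains h where "h \<in> cbox a b" "f h = 0"
proof -
  obtain h where "h \<in> cbox a b" "h - f h = h"
  proof (rule brouwer[of "cbox a b" "\<lambda>h. h - f h"])
    show "continuous_on (cbox a b) (\<lambda>h. h - f h)"
      by (intro continuous_on_diff continuous_on_id assms(1))
  qed (use assms in auto)
  then show thesis using that by simp
qed

section \<open>Taylor models with integer coefficients\<close>

type_synonym taylor = "int \<times> int \<times> int \<times> int \<times> int"

text \<open>Fixed-point numbers with scale \<open>S\<close> keep the coefficients integral, so that
  rounding occurs only in \<open>taylor_div\<close>.\<close>

fun encloses :: "real \<times> real \<times> real \<Rightarrow> real \<Rightarrow> taylor \<Rightarrow> real \<Rightarrow> bool" where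
  "encloses (h1, h2, h3) S (c, l1, l2, l3, r) x \<longleftrightarrow>
     \<bar>S * x - (c + l1 * h1 + l2 * h2 + l3 * h3)\<bar> \<le> r"

fun taylor_add :: "taylor \<Rightarrow> taylor \<Rightarrow> taylor" where
  "taylor_add (c, l1, l2, l3, r) (c', l1', l2', l3', r') = (c + c', l1 + l1', l2 + l2', l3 + l3', r + r')"

fun taylor_scale :: "int \<Rightarrow> taylor \<Rightarrow> taylor" where
  "taylor_scale k (c, l1, l2, l3, r) = (k * c, k * l1, k * l2, k * l3, \<bar>k\<bar> * r)"

text \<open>The product of the two linear parts goes into the remainder, bounded on the cube by sums
  of absolute values. The product of the two errors is counted once, as
  \<open>r * r'\<close>.\<close>

fun taylor_mult :: "taylor \<Rightarrow> taylor \<Rightarrow> taylor" where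
  "taylor_mult (c, l1, l2, l3, r) (c', l1', l2', l3', r') =
     (c * c', c * l1' + c' * l1, c * l2' + c' * l2, c * l3' + c' * l3,
      (\<bar>l1\<bar> + \<bar>l2\<bar> + \<bar>l3\<bar>) * (\<bar>l1'\<bar> + \<bar>l2'\<bar> + \<bar>l3'\<bar>) +
      (\<bar>c\<bar> + (\<bar>l1\<bar> + \<bar>l2\<bar> + \<bar>l3\<bar>) + r) * r' + (\<bar>c'\<bar> + (\<bar>l1'\<bar> + \<bar>l2'\<bar> + \<bar>l3'\<bar>)) * r)"

text \<open>Each of the four roundings contributes an error below \<open>1\<close>, and so does the one of the bound.\<close>

fun taylor_div :: "taylor \<Rightarrow> int \<Rightarrow> taylor" where
  "taylor_div (c, l1, l2, l3, r) k = (c div k, l1 div k, l2 div k, l3 div k, r div \<bar>k\<bar> + 5)"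

definition unit_cube :: "(real \<times> real \<times> real) set" where
  "unit_cube = cbox (-1, -1, -1) (1, 1, 1)"

lemma unit_cube_iff: "(h1, h2, h3) \<in> unit_cube \<longleftrightarrow> \<bar>h1\<bar> \<le> 1 \<and> \<bar>h2\<bar> \<le> 1 \<and> \<bar>h3\<bar> \<le> 1"
  by (auto simp: unit_cube_def cbox_Pair_eq)

lemma encloses_add:
  "encloses h S m x \<Longrightarrow> encloses h S m' x' \<Longrightarrow> encloses h S (taylor_add m m') (x + x')"
  by (cases h; cases m; cases m') (auto simp: algebra_simps)

lemma encloses_scale: "encloses h S m x \<Longrightarrow> encloses h S (taylor_scale k m) (of_int k * x)"
proof (cases h; cases m)
  fix h1 h2 h3 c l1 l2 l3 r
  assume "h = (h1, h2, h3)" "m = (c, l1, l2, l3, r)" "encloses h S m x"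
  moreover from this have "\<bar>real_of_int k\<bar> * \<bar>S * x - (c + l1 * h1 + l2 * h2 + l3 * h3)\<bar> \<le> \<bar>real_of_int k\<bar> * real_of_int r"
    by (intro mult_left_mono) auto
  ultimately show ?thesis by (simp add: abs_mult[symmetric] algebra_simps)
qed

lemma encloses_rescale: "encloses h S m x \<Longrightarrow> encloses h (of_int k * S) (taylor_scale k m) x"
  using encloses_scale[of h S m x k] by (cases h; cases m) (simp add: mult_ac)

lemma linear_form_bound:
  fixes h1 h2 h3 :: real
  assumes "\<bar>h1\<bar> \<le> 1" "\<bar>h2\<bar> \<le> 1" "\<bar>h3\<bar> \<le> 1"
  shows "\<bar>l1 * h1 + l2 * h2 + l3 * h3\<bar> \<le> \<bar>l1\<bar> + \<bar>l2\<bar> + \<bar>l3\<bar>"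
proof -
  have "\<bar>l * h\<bar> \<le> \<bar>l\<bar>" if "\<bar>h\<bar> \<le> 1" for l h :: real
    using mult_left_mono[OF that, of "\<bar>l\<bar>"] by (simp add: abs_mult)
  from this[OF assms(1), of l1] this[OF assms(2), of l2] this[OF assms(3), of l3] show ?thesis by linarith
qed

lemma encloses_mult:
  assumes h: "h \<in> unit_cube" and m: "encloses h S m x" and m': "encloses h S' m' x'"
  shows "encloses h (S * S') (taylor_mult m m') (x * x')"
proof -
  obtain h1 h2 h3 where h': "h = (h1, h2, h3)" by (cases h)
  obtain c l1 l2 l3 r where mm: "m = (c, l1, l2, l3, r)" by (cases m)
  obtain c' l1' l2' l3' r' where mm': "m' = (c', l1', l2', l3', r')" by (cases m')
  define L L' where "L = l1 * h1 + l2 * h2 + l3 * h3" and "L' = l1' * h1 + l2' * h2 + l3' * h3"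
  define B B' where "B = real_of_int (\<bar>l1\<bar> + \<bar>l2\<bar> + \<bar>l3\<bar>)" and "B' = real_of_int (\<bar>l1'\<bar> + \<bar>l2'\<bar> + \<bar>l3'\<bar>)"
  define e e' where "e = S * x - (c + L)" and "e' = S' * x' - (c' + L')"
  have LB: "\<bar>L\<bar> \<le> B" "\<bar>L'\<bar> \<le> B'"
    using h linear_form_bound[of h1 h2 h3] unfolding h' unit_cube_iff L_def L'_def B_def B'_def by auto
  have e: "\<bar>e\<bar> \<le> r" "\<bar>e'\<bar> \<le> r'"
    using m m' unfolding h' mm mm' e_def e'_def L_def L'_def by (auto simp: algebra_simps)
  have "\<bar>L * L'\<bar> \<le> B * B'" using LB by (simp add: abs_mult mult_mono')
  moreover have "\<bar>(c + L + e) * e'\<bar> \<le> (\<bar>c\<bar> + B + r) * r'"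
  proof -
    have "\<bar>c + L + e\<bar> \<le> \<bar>c\<bar> + B + r" using LB e by linarith
    then show ?thesis using e by (simp add: abs_mult mult_mono')
  qed
  moreover have "\<bar>(c' + L') * e\<bar> \<le> (\<bar>c'\<bar> + B') * r"
  proof -
    have "\<bar>c' + L'\<bar> \<le> \<bar>c'\<bar> + B'" using LB e by linarith
    then show ?thesis using e by (simp add: abs_mult mult_mono')
  qed
  moreover have "S * S' * (x * x') - (c * c' + (c * L' + c' * L)) = L * L' + (c + L + e) * e' + (c' + L') * e"
    by (simp add: e_def e'_def algebra_simps)
  ultimately have "\<bar>S * S' * (x * x') - (c * c' + (c * L' + c' * L))\<bar> \<le> B * B' + (\<bar>c\<bar> + B + r) * r' + (\<bar>c'\<bar> + B') * r"
    by linarith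
  then show ?thesis
    unfolding h' mm mm' L_def L'_def B_def B'_def by (simp add: algebra_simps)
qed

lemma of_int_div_bounds:
  fixes a k :: int
  assumes "k \<noteq> 0"
  shows "\<bar>of_int a / of_int k - real_of_int (a div k)\<bar> \<le> 1"
proof -
  have "a div k = \<lfloor>of_int a / real_of_int k\<rfloor>" by (simp add: floor_divide_of_int_eq)
  then show ?thesis by linarith
qed

lemma encloses_div:
  assumes h: "h \<in> unit_cube" and m: "encloses h (k * S) m x" and "k * d \<noteq> 0"
  shows "encloses h S (taylor_div m (k * d)) (x / real_of_int d)"
proof -
  obtain h1 h2 h3 where h': "h = (h1, h2, h3)" by (cases h)
  obtain c l1 l2 l3 r where mm: "m = (c, l1, l2, l3, r)" by (cases m)
  define q where "q = k * d"
  define \<delta> where "\<delta> = (\<lambda>a. of_int a / of_int q - real_of_int (a div q))"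
  have q: "q \<noteq> 0" using assms(3) by (simp add: q_def)
  have \<delta>: "\<bar>\<delta> a\<bar> \<le> 1" for a using of_int_div_bounds[OF q] by (simp add: \<delta>_def)
  have \<delta>h: "\<bar>\<delta> a * t\<bar> \<le> 1" if "\<bar>t\<bar> \<le> 1" for a t
    using mult_mono[OF \<delta> that] by (simp add: abs_mult)
  have "\<bar>k * S * x - (c + l1 * h1 + l2 * h2 + l3 * h3)\<bar> \<le> r" using m by (simp add: h' mm)
  then have "\<bar>(k * S * x - (c + l1 * h1 + l2 * h2 + l3 * h3)) / q\<bar> \<le> r / \<bar>q\<bar>"
    by (simp add: abs_divide divide_right_mono)
  also have "(k * S * x - (c + l1 * h1 + l2 * h2 + l3 * h3)) / q =
      S * (x / d) - ((c div q) + (l1 div q) * h1 + (l2 div q) * h2 + (l3 div q) * h3)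
      - (\<delta> c + \<delta> l1 * h1 + \<delta> l2 * h2 + \<delta> l3 * h3)"
    using assms(3) by (simp add: \<delta>_def q_def field_simps)
  finally have main: "\<bar>S * (x / d) - ((c div q) + (l1 div q) * h1 + (l2 div q) * h2 + (l3 div q) * h3)
      - (\<delta> c + \<delta> l1 * h1 + \<delta> l2 * h2 + \<delta> l3 * h3)\<bar> \<le> r / \<bar>q\<bar>" .
  have four: "\<bar>t1 + t2 + t3 + t4\<bar> \<le> 4" if "\<bar>t1\<bar> \<le> 1" "\<bar>t2\<bar> \<le> 1" "\<bar>t3\<bar> \<le> 1" "\<bar>t4\<bar> \<le> 1" for t1 t2 t3 t4 :: real
    using that by linarith
  have rounding: "\<bar>\<delta> c + \<delta> l1 * h1 + \<delta> l2 * h2 + \<delta> l3 * h3\<bar> \<le> 4"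
    using h unfolding h' unit_cube_iff by (intro four \<delta> \<delta>h) auto
  have bound: "r / \<bar>q\<bar> \<le> real_of_int (r div \<bar>q\<bar>) + 1"
    using of_int_div_bounds[of "\<bar>q\<bar>" r] q unfolding abs_le_iff by simp
  have combine: "\<bar>a\<bar> \<le> b' + 5" if "\<bar>a - e\<bar> \<le> b" "\<bar>e\<bar> \<le> 4" "b \<le> b' + 1" for a b b' e :: real
    using that by linarith
  show ?thesis
    using combine[OF main rounding bound] unfolding h' mm q_def[symmetric] by simp
qed

text \<open>The constant terms approximate the solution. The linear terms are multiples of the columns of the
  inverse Jacobian matrix there, so that the three equations become nearly the coordinates.\<close>

definition taylor_unit :: int where "taylor_unit = 1000000000000000000000000"

definition B_taylor :: taylor where
  "B_taylor = (950627623763333370723624, -10309579782, 18134822659, 572111685017, 0)"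
definition C_taylor :: taylor where
  "C_taylor = (-510610282567976824631218, 35909496303, 69322320233, 2277018285790, 0)"
definition D_taylor :: taylor where
  "D_taylor = (-315645549526881228590935, -274371264, -13740656555, -443890041626, 0)"

text \<open>One step of \<open>integral_coeff\<close> with \<open>m = 3 * i + 1\<close>;
  \<open>x\<close>, \<open>y\<close>, \<open>z\<close> enclose the entries at
  \<open>(i, j - 1)\<close>, \<open>(i, j - 2)\<close>, \<open>(i - 1, j + 1)\<close>. The products
  have scale \<open>taylor_unit\<close> squared, hence the extra factor on \<open>z\<close> and in
  the divisor.\<close>

definition taylor_next :: "int \<Rightarrow> int \<Rightarrow> taylor \<Rightarrow> taylor \<Rightarrow> taylor \<Rightarrow> taylor" where
  "taylor_next m j x y z =
    (if m = 1 \<and> j = 1 then (taylor_unit, 0, 0, 0, 0) else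
       taylor_div
        (taylor_add (taylor_add
          (taylor_mult (taylor_add (taylor_unit * m, 0, 0, 0, 0) (taylor_scale (j - 1) C_taylor)) x)
          (taylor_mult (taylor_add (taylor_scale m B_taylor) (taylor_scale (j - 2) D_taylor)) y))
          (taylor_scale taylor_unit (taylor_scale (j + 1) z)))
        (taylor_unit * (if j = m then 1 else j - m)))"

text \<open>Row \<open>i\<close> lists enclosures of the coefficients \<open>integral_coeff B C D i j\<close> for \<open>j = -1, 0, 1, \<dots>\<close>
  where the entry at \<open>-1\<close> is \<open>0\<close>. Emitting the previous entry rather than the new one keeps rewriting
  from evaluating the new one twice.\<close>

primrec taylor_row :: "int \<Rightarrow> taylor list \<Rightarrow> int \<Rightarrow> taylor \<Rightarrow> taylor \<Rightarrow> taylor list" where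
  "taylor_row m [] j x y = [x]"
| "taylor_row m (z # zs) j x y = x # taylor_row m zs (j + 1) (taylor_next m j x y z) x"

definition taylor_zero :: taylor where "taylor_zero = (0, 0, 0, 0, 0)"

text \<open>Column \<open>j\<close> needs column \<open>j + 1\<close> of the previous row, which
  stands at position \<open>j + 2\<close> because rows start at column \<open>-1\<close>; hence two
  tails.\<close>

definition taylor_step :: "int \<Rightarrow> taylor list \<Rightarrow> taylor list" where
  "taylor_step m zs = taylor_row m (tl (tl zs)) 0 taylor_zero taylor_zero"

text \<open>Zeros stand for the row before the first. Each step loses one entry, so twenty of them
  leave 15 entries in row 4, the last being column 13.\<close>

primrec taylor_rows :: "nat \<Rightarrow> taylor list" where
  "taylor_rows 0 = taylor_step 1 (replicate 20 taylor_zero)"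
| "taylor_rows (Suc i) = taylor_step (int (3 * Suc i + 1)) (taylor_rows i)"

text \<open>A single pass over the rows, so that one evaluation yields all diagonal entries.\<close>

primrec taylor_diagonal :: "nat \<Rightarrow> nat \<Rightarrow> taylor list \<Rightarrow> taylor list" where
  "taylor_diagonal 0 i zs = []"
| "taylor_diagonal (Suc n) i zs =
    zs ! (3 * i + 2) # taylor_diagonal n (Suc i) (taylor_step (int (3 * Suc i + 1)) zs)"

lemma taylor_diagonal_rows:
  "taylor_diagonal n i (taylor_rows i) = map (\<lambda>k. taylor_rows k ! (3 * k + 2)) [i..<i + n]"
proof (induction n arbitrary: i)
  case (Suc n)
  from Suc[of "Suc i"] show ?case by (simp add: upt_rec[of i "Suc (i + n)"] del: upt_Suc)
qed simp

text \<open>Entries 1 to 3 are nearly \<open>10^9 h1\<close>, \<open>10^8 h2\<close>,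
  \<open>10^11 h3\<close>, with deviations of at most a few percent of these factors on the cube.
  Entry 4, about 0.00136 after division by \<open>taylor_unit\<close>, stays away from zero.\<close>

lemma taylor_diagonal_values:
  "taylor_diagonal 5 0 (taylor_rows 0) =
    [(1000000000000000000000000, 0, 0, 0, 0),
     (7, 1000000003, 4, 6, 981),
     (-161, -17, 100000119, -62, 1015255),
     (4910, -41, -3404, 100000001829, 5825294886),
     (1357029601265707847009, -6902109496, -9855401704, -15477497658939, 117082594227062)]"
  by code_simp

lemma taylor_values:
  "taylor_rows 1 ! 5 = (7, 1000000003, 4, 6, 981)"
  "taylor_rows 2 ! 8 = (-161, -17, 100000119, -62, 1015255)"
  "taylor_rows 3 ! 11 = (4910, -41, -3404, 100000001829, 5825294886)"
  "taylor_rows 4 ! 14 =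
    (1357029601265707847009, -6902109496, -9855401704, -15477497658939, 117082594227062)"
proof -
  have "taylor_rows k ! (3 * k + 2) = taylor_diagonal 5 0 (taylor_rows 0) ! k" if "k < 5" for k
    unfolding taylor_diagonal_rows using that by (simp del: taylor_rows.simps)
  from this[of 1] this[of 2] this[of 3] this[of 4] show
    "taylor_rows 1 ! 5 = (7, 1000000003, 4, 6, 981)"
    "taylor_rows 2 ! 8 = (-161, -17, 100000119, -62, 1015255)"
    "taylor_rows 3 ! 11 = (4910, -41, -3404, 100000001829, 5825294886)"
    "taylor_rows 4 ! 14 =
      (1357029601265707847009, -6902109496, -9855401704, -15477497658939, 117082594227062)"
    unfolding taylor_diagonal_values by (simp_all del: taylor_rows.simps)
qed

section \<open>Continuity of the coefficients and correctness of the enclosures\<close>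

fun taylor_value :: "taylor \<Rightarrow> real \<times> real \<times> real \<Rightarrow> real" where
  "taylor_value (c, l1, l2, l3, r) (h1, h2, h3) = (c + l1 * h1 + l2 * h2 + l3 * h3) / taylor_unit"

lemma encloses_params:
  "encloses h taylor_unit B_taylor (taylor_value B_taylor h)"
  "encloses h taylor_unit C_taylor (taylor_value C_taylor h)"
  "encloses h taylor_unit D_taylor (taylor_value D_taylor h)"
  by (cases h; simp add: B_taylor_def C_taylor_def D_taylor_def taylor_unit_def)+

lemma continuous_taylor_value: "continuous_on A (taylor_value m)"
proof -
  obtain c l1 l2 l3 r where m: "m = (c, l1, l2, l3, r)" by (cases m)
  have "taylor_value m = (\<lambda>h. (real_of_int c + real_of_int l1 * fst h + real_of_int l2 * fst (snd h) +
      real_of_int l3 * snd (snd h)) / real_of_int taylor_unit)"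
    by (auto simp: m fun_eq_iff)
  moreover have "continuous_on A \<dots>"
    by (intro continuous_intros) (simp add: taylor_unit_def)
  ultimately show ?thesis by simp
qed

lemma continuous_integral_coeff:
  fixes B C D :: "'a::topological_space \<Rightarrow> real"
  assumes "continuous_on A B" "continuous_on A C" "continuous_on A D"
  shows "continuous_on A (\<lambda>h. integral_coeff (B h) (C h) (D h) i j)"
\<comment> \<open>The recursion pattern depends only on \<open>i\<close> and \<open>j\<close>, so
  the rule is taken at arbitrary parameter values.\<close>
proof (induction "0::real" "0::real" "0::real" i j rule: integral_coeff.induct)
  case (1 i j)
  show ?case
  proof (cases "i = 0 \<and> j = 1")
    case True
    then show ?thesis by (simp add: integral_coeff.simps)
  next
    case False
    have "continuous_on A (\<lambda>h. if j = 0 then 0 else integral_coeff (B h) (C h) (D h) i (j - 1))"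
      using 1(1)[OF False] by (cases "j = 0") auto
    moreover have "continuous_on A (\<lambda>h. if j < 2 then 0 else integral_coeff (B h) (C h) (D h) i (j - 2))"
      using 1(2)[OF False] by (cases "j < 2") auto
    moreover have "continuous_on A (\<lambda>h. if i = 0 then 0 else integral_coeff (B h) (C h) (D h) (i - 1) (j + 1))"
      using 1(3)[OF False] by (cases "i = 0") auto
    ultimately show ?thesis
      unfolding integral_coeff.simps[of _ _ _ i j] if_not_P[OF False]
      by (intro continuous_on_divide continuous_on_add continuous_on_mult continuous_on_const assms) auto
  qed
qed

context
  fixes h :: "real \<times> real \<times> real"
  assumes h: "h \<in> unit_cube"
begin

abbreviation coeff_at :: "nat \<Rightarrow> nat \<Rightarrow> real" where
  "coeff_at \<equiv> integral_coeff (taylor_value B_taylor h) (taylor_value C_taylor h) (taylor_value D_taylor h)"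

lemma encloses_taylor_next:
  assumes x: "encloses h taylor_unit x (if j = 0 then 0 else coeff_at i (j - 1))"
    and y: "encloses h taylor_unit y (if j < 2 then 0 else coeff_at i (j - 2))"
    and z: "encloses h taylor_unit z (if i = 0 then 0 else coeff_at (i - 1) (j + 1))"
  shows "encloses h taylor_unit (taylor_next (int (3 * i + 1)) (int j) x y z) (coeff_at i j)"
proof (cases "i = 0 \<and> j = 1")
  case True
  then show ?thesis by (cases h) (simp add: taylor_next_def integral_coeff.simps taylor_unit_def)
next
  case False
  define m where "m = int (3 * i + 1)"
  define d where "d = (if j = 3 * i + 1 then 1 else int j - m)"
  have d: "d \<noteq> 0" by (auto simp: d_def m_def)
  have const: "encloses h taylor_unit (taylor_unit * m, 0, 0, 0, 0) (of_int m)"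
    by (cases h) simp
  note num = encloses_add[OF encloses_add[OF
    encloses_mult[OF h encloses_add[OF const encloses_scale[OF encloses_params(2), where k = "int j - 1"]] x]
    encloses_mult[OF h encloses_add[OF encloses_scale[OF encloses_params(1), where k = m]
      encloses_scale[OF encloses_params(3), where k = "int j - 2"]] y]]
    encloses_rescale[OF encloses_scale[OF z, where k = "int j + 1"], where k = taylor_unit]]
  have "taylor_unit * d \<noteq> 0" using d by (simp add: taylor_unit_def)
  note quot = encloses_div[OF h num this]
  have 1: "coeff_at i j =
     ((of_int m + of_int (int j - 1) * taylor_value C_taylor h) * (if j = 0 then 0 else coeff_at i (j - 1)) +
      (of_int m * taylor_value B_taylor h + of_int (int j - 2) * taylor_value D_taylor h) *
        (if j < 2 then 0 else coeff_at i (j - 2)) +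
      of_int (int j + 1) * (if i = 0 then 0 else coeff_at (i - 1) (j + 1))) / of_int d"
  proof -
    have casts: "real (3 * i + 1) = of_int m" "real j - 1 = of_int (int j - 1)"
      "real j - 2 = of_int (int j - 2)" "real (j + 1) = of_int (int j + 1)"
      "(if j = 3 * i + 1 then 1 else real j - of_int m) = of_int d"
      by (auto simp: m_def d_def)
    show ?thesis unfolding integral_coeff.simps[of _ _ _ i j] if_not_P[OF False] casts ..
  qed
  have 2: "taylor_next m (int j) x y z = taylor_div
        (taylor_add (taylor_add
          (taylor_mult (taylor_add (taylor_unit * m, 0, 0, 0, 0) (taylor_scale (int j - 1) C_taylor)) x)
          (taylor_mult (taylor_add (taylor_scale m B_taylor) (taylor_scale (int j - 2) D_taylor)) y))
          (taylor_scale taylor_unit (taylor_scale (int j + 1) z))) (taylor_unit * d)"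
    using False by (auto simp: taylor_next_def d_def m_def)
  show ?thesis using quot unfolding m_def[symmetric] 1 2 .
qed

lemma length_taylor_row [simp]: "length (taylor_row m zs j x y) = Suc (length zs)"
  by (induction zs arbitrary: j x y) auto

lemma encloses_taylor_row:
  assumes "\<And>k. k < length zs \<Longrightarrow> encloses h taylor_unit (zs ! k) (if i = 0 then 0 else coeff_at (i - 1) (j + k + 1))"
    and "encloses h taylor_unit x (if j = 0 then 0 else coeff_at i (j - 1))"
    and "encloses h taylor_unit y (if j < 2 then 0 else coeff_at i (j - 2))"
    and "k \<le> length zs"
  shows "encloses h taylor_unit (taylor_row (int (3 * i + 1)) zs (int j) x y ! k)
    (if j + k = 0 then 0 else coeff_at i (j + k - 1))"
  using assms
proof (induction zs arbitrary: j x y k)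
  case Nil
  then show ?case by (cases "j = 0") auto
next
  case (Cons z zs)
  show ?case
  proof (cases k)
    case 0
    then show ?thesis using Cons.prems(2) by (cases "j = 0") auto
  next
    case (Suc k')
    have "encloses h taylor_unit z (if i = 0 then 0 else coeff_at (i - 1) (j + 1))"
      using Cons.prems(1)[of 0] by (cases "i = 0") auto
    then have "encloses h taylor_unit (taylor_next (int (3 * i + 1)) (int j) x y z) (coeff_at i j)"
      by (rule encloses_taylor_next[OF Cons.prems(2,3)])
    moreover have "encloses h taylor_unit (zs ! l) (if i = 0 then 0 else coeff_at (i - 1) (Suc j + l + 1))"
      if "l < length zs" for l
      using Cons.prems(1)[of "Suc l"] that by (cases "i = 0") auto
    moreover have "encloses h taylor_unit x (if Suc j < 2 then 0 else coeff_at i (Suc j - 2))"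
      using Cons.prems(2) by (cases "j = 0") (auto simp: numeral_2_eq_2)
    ultimately have "encloses h taylor_unit (taylor_row (int (3 * i + 1)) zs (int (Suc j))
        (taylor_next (int (3 * i + 1)) (int j) x y z) x ! k')
      (if Suc j + k' = 0 then 0 else coeff_at i (Suc j + k' - 1))"
      using Cons.prems(4) Suc by (intro Cons.IH) auto
    then show ?thesis by (simp add: Suc add.commute)
  qed
qed

lemma encloses_taylor_zero: "encloses h S taylor_zero 0"
  by (cases h) (simp add: taylor_zero_def)

lemma encloses_taylor_step:
  assumes "\<And>k. k < length zs \<Longrightarrow> encloses h taylor_unit (zs ! k) (if i = 0 \<or> k = 0 then 0 else coeff_at (i - 1) (k - 1))"
    and "k < length (taylor_step (int (3 * i + 1)) zs)"
  shows "encloses h taylor_unit (taylor_step (int (3 * i + 1)) zs ! k) (if k = 0 then 0 else coeff_at i (k - 1))"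
proof -
  have "encloses h taylor_unit (tl (tl zs) ! l) (if i = 0 then 0 else coeff_at (i - 1) (0 + l + 1))"
    if "l < length (tl (tl zs))" for l
    using assms(1)[of "l + 2"] that by (cases "i = 0") (auto simp: nth_tl)
  from encloses_taylor_row[OF this, where x = taylor_zero and y = taylor_zero and k = k]
  show ?thesis using assms(2) encloses_taylor_zero by (auto simp: taylor_step_def)
qed

lemma encloses_taylor_rows:
  "k < length (taylor_rows i) \<Longrightarrow>
    encloses h taylor_unit (taylor_rows i ! k) (if k = 0 then 0 else coeff_at i (k - 1))"
proof (induction i arbitrary: k)
  case 0
  have "encloses h taylor_unit (taylor_step (int (3 * 0 + 1)) (replicate 20 taylor_zero) ! k)
      (if k = 0 then 0 else coeff_at 0 (k - 1))"
    by (rule encloses_taylor_step) (use 0 encloses_taylor_zero in auto)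
  then show ?case by simp
next
  case (Suc i)
  show ?case
    unfolding taylor_rows.simps
  proof (rule encloses_taylor_step)
    show "encloses h taylor_unit (taylor_rows i ! k) (if Suc i = 0 \<or> k = 0 then 0 else coeff_at (Suc i - 1) (k - 1))"
      if "k < length (taylor_rows i)" for k
      using Suc.IH[OF that] by (cases "k = 0") auto
  qed (use Suc.prems in simp)
qed

lemma length_taylor_rows: "length (taylor_rows i) = (if i = 0 then 19 else max 1 (19 - i))"
  by (induction i) (auto simp: taylor_step_def)

lemma encloses_diagonal:
  assumes "i \<le> 4"
  shows "encloses h taylor_unit (taylor_rows i ! (3 * i + 2)) (coeff_at i (3 * i + 1))"
proof -
  have "3 * i + 2 < length (taylor_rows i)"
    using assms unfolding length_taylor_rows by (cases "i = 0") auto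
  from encloses_taylor_rows[OF this] show ?thesis by simp
qed

end

lemma coefficients_exist:
  obtains B C D where "integral_coeff B C D 1 4 = 0" "integral_coeff B C D 2 7 = 0"
    "integral_coeff B C D 3 10 = 0" "integral_coeff B C D 4 13 \<noteq> 0"
proof -
  define g where "g = (\<lambda>i j h. integral_coeff (taylor_value B_taylor h) (taylor_value C_taylor h) (taylor_value D_taylor h) i j)"
  \<comment> \<open>The factors divide out the dominant linear coefficients, which brings
    \<open>f\<close> close to the identity on the cube.\<close>
  define f where "f = (\<lambda>h. (taylor_unit / 10 ^ 9 * g 1 4 h, taylor_unit / 10 ^ 8 * g 2 7 h, taylor_unit / 10 ^ 11 * g 3 10 h))"
  have encl: "encloses h taylor_unit (taylor_rows 1 ! 5) (g 1 4 h)" "encloses h taylor_unit (taylor_rows 2 ! 8) (g 2 7 h)"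
    "encloses h taylor_unit (taylor_rows 3 ! 11) (g 3 10 h)" "encloses h taylor_unit (taylor_rows 4 ! 14) (g 4 13 h)"
    if "h \<in> unit_cube" for h
    using encloses_diagonal[OF that, of 1] encloses_diagonal[OF that, of 2]
      encloses_diagonal[OF that, of 3] encloses_diagonal[OF that, of 4] by (simp_all add: g_def)
  have cont: "continuous_on unit_cube (g i j)" for i j
    unfolding g_def by (intro continuous_integral_coeff continuous_taylor_value)
  obtain h where h: "h \<in> unit_cube" "f h = 0"
    unfolding unit_cube_def
  proof (rule zero_near_identity[of "(-1, -1, -1)" "(1, 1, 1)" f])
    show "continuous_on (cbox (-1, -1, -1) (1, 1, 1)) f"
      unfolding f_def unit_cube_def[symmetric] by (intro continuous_intros cont)
    show "(0 :: real \<times> real \<times> real) \<in> cbox (-1, -1, -1) (1, 1, 1)"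
      unfolding unit_cube_def[symmetric] zero_prod_def by (simp add: unit_cube_iff)
    fix h :: "real \<times> real \<times> real"
    assume "h \<in> cbox (-1, -1, -1) (1, 1, 1)"
    then have h: "h \<in> unit_cube" by (simp add: unit_cube_def)
    obtain h1 h2 h3 where h': "h = (h1, h2, h3)" by (cases h)
    have "h - f h \<in> unit_cube"
      using encl(1-3)[OF h] h unfolding taylor_values h' unit_cube_iff f_def
      by (simp add: unit_cube_iff taylor_unit_def abs_le_iff)
    then show "h - f h \<in> cbox (-1, -1, -1) (1, 1, 1)" by (simp add: unit_cube_def)
  qed
  have "g 1 4 h = 0" "g 2 7 h = 0" "g 3 10 h = 0"
    using h(2) by (simp_all add: f_def taylor_unit_def zero_prod_def)
  \<comment> \<open>The constant term of this enclosure far exceeds the linear coefficients and the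
    remainder together.\<close>
  moreover have "g 4 13 h \<noteq> 0"
    using encl(4)[OF h(1)] h(1) unfolding taylor_values
    by (cases h) (auto simp: unit_cube_iff taylor_unit_def abs_le_iff)
  ultimately show thesis using that unfolding g_def by blast
qed

section \<open>The twelfth focal value\<close>

lemma twelfth_focal_value:
  assumes "focal_values 3 F s"
  obtains p q where "nonlinear_part 3 p" "nonlinear_part 3 q"
    "\<forall>j\<in>{1..11}. s p q j = 0" "s p q 12 \<noteq> 0"
proof -
  obtain B C D where BCD: "integral_coeff B C D 1 4 = 0" "integral_coeff B C D 2 7 = 0"
    "integral_coeff B C D 3 10 = 0" "integral_coeff B C D 4 13 \<noteq> 0"
    by (rule coefficients_exist)
  let ?p = "cubic_p B C D" and ?q = "cubic_q B C D"
  interpret cubic_system B C D "fps2_of_poly2 (X2 + ?p)" "fps2_of_poly2 (Y2 + ?q)"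
    by (rule cubic_system_cubic)
  have eq: "focal_equation ?p ?q (F ?p ?q) (s ?p ?q)"
    using assms nonlinear_part_cubic unfolding focal_values_def by blast
  \<comment> \<open>The obstruction at \<open>(u v)^13\<close> has degree 26, which corresponds to
    the focal value of index 12.\<close>
  have "(\<forall>j\<in>{1..<13-1}. s ?p ?q j = 0) \<and> s ?p ?q (13 - 1) \<noteq> 0"
  proof (rule first_focal_value[where P = "fps2_of_poly2 (X2 + ?p)" and Q = "fps2_of_poly2 (Y2 + ?q)"
        and F = "F ?p ?q" and G = first_integral and c = "- \<i> * \<beta> 4 13"])
    show "order_ge 3 (first_integral - circ)" by (rule integral_leading)
    show "order_ge (2 * 13 + 1) (lie (fps2_of_poly2 (X2 + ?p)) (fps2_of_poly2 (Y2 + ?q)) first_integral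
        - scalar (- \<i> * \<beta> 4 13) * circ ^ 13)"
      using lie_integral[OF BCD(1-3)] by simp
    show "lie (fps2_of_poly2 (X2 + ?p)) (fps2_of_poly2 (Y2 + ?q)) (F ?p ?q) = focal_rhs (s ?p ?q)"
      using eq by (simp add: focal_equation_def lie_def)
  qed (use BCD(4) eq in \<open>auto intro: rotation_like_nonlinear nonlinear_part_cubic focal_equation_leading\<close>)
  then show thesis
    by (intro that[of ?p ?q] nonlinear_part_cubic) auto
qed

theorem theorem2p5:
  fixes F :: "poly2 \<Rightarrow> poly2 \<Rightarrow> fps2"
    and s :: "poly2 \<Rightarrow> poly2 \<Rightarrow> nat \<Rightarrow> complex"
  assumes "focal_values 3 F s"
  shows "12 \<le> m_focal 3 s \<and>
    (\<exists>p q. nonlinear_part 3 p \<and> nonlinear_part 3 q \<and>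
       (\<forall>j\<in>{1..11}. s p q j = 0) \<and> (\<exists>j\<ge>12. s p q j \<noteq> 0))"
proof -
  obtain p q where pq: "nonlinear_part 3 p" "nonlinear_part 3 q"
    "\<forall>j\<in>{1..11}. s p q j = 0" "s p q 12 \<noteq> 0"
    by (rule twelfth_focal_value[OF assms])
  have "12 \<le> m" if "vanishing_suffices 3 s m" for m
  proof (rule ccontr)
    assume "\<not> 12 \<le> m"
    then have "\<forall>j\<in>{1..m}. s p q j = 0" using pq(3) by auto
    then have "s p q 12 = 0"
      using that pq(1,2) unfolding vanishing_suffices_def by (metis one_le_numeral)
    then show False using pq(4) by simp
  qed
  then have "12 \<le> m_focal 3 s"
    unfolding m_focal_def by (intro INF_greatest) (auto simp: numeral_eq_enat)
  then show ?thesis using pq by blast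
qed

end
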